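(* Let $\mathbb{F}$ be a field of characteristic different from $2$, let $V$ be an $n$-dimensional vector space over $\mathbb{F}$, and let $b$ be a non-degenerate symmetric bilinear form on $V$ with Witt index $\nu$. Let $\mathcal{V}$ be a linear subspace of $\mathcal{S}_b$ consisting only of nilpotent endomorphisms, with $\dim\mathcal{V}=\nu(n-\nu)$. Then there exists a maximal partially complete $b$-singular flag $\mathcal{F}$ of $V$ such that $\mathcal{V}=\mathrm{WS}_{b,\mathcal{F}}$.
   Context: The Witt index of $b$ is the maximal dimension of a linear subspace $X\subseteq V$ that is totally singular, i.e. $b(x,y)=0$ for all $x,y\in X$. An endomorphism $u$ of $V$ is $b$-symmetric if $(x,y)\mapsto b(x,u(y))$ is a symmetric bilinear form; $\mathcal{S}_b$ is the space of $b$-symmetric endomorphisms. A flag of $V$ is an increasing sequence $\mathcal{F}=(F_0,\dots,F_p)$ of linear subspaces; it is partially complete if $\dim F_i=i$ for all $i$; it is $b$-singular if $F_p$ is totally singular for $b$; a partially complete $b$-singular flag is maximal if $p$ equals the Witt index of $b$. An endomorphism $u$ stabilizes $\mathcal{F}$ if $u(F_i)\subseteq F_i$ for all $i$. $\mathrm{WS}_{b,\mathcal{F}}$ denotes the set of all nilpotent $u\in\mathcal{S}_b$ that stabilize $\mathcal{F}$. *)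

theory Defs
  imports Main "HOL.Vector_Spaces" "HOL-Library.Function_Algebras"
begin

text \<open>V is modelled by a type 'v with scalar multiplication scale over a field 'a.
Endomorphisms are functions 'v => 'v (linear ones), forming a vector space under
pointwise operations with scalar multiplication end_scale.\<close>

definition end_scale :: "('a \<Rightarrow> 'v \<Rightarrow> 'v) \<Rightarrow> 'a \<Rightarrow> ('v \<Rightarrow> 'v) \<Rightarrow> ('v \<Rightarrow> 'v)" where
  "end_scale scale c u = (\<lambda>x. scale c (u x))"

definition bilinear_form :: "('a::field \<Rightarrow> 'v::ab_group_add \<Rightarrow> 'v) \<Rightarrow> ('v \<Rightarrow> 'v \<Rightarrow> 'a) \<Rightarrow> bool" where
  "bilinear_form scale b \<longleftrightarrow>
     (\<forall>x. Vector_Spaces.linear scale (*) (b x)) \<and> (\<forall>y. Vector_Spaces.linear scale (*) (\<lambda>x. b x y))"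

definition symmetric_form :: "('v \<Rightarrow> 'v \<Rightarrow> 'a) \<Rightarrow> bool" where
  "symmetric_form b \<longleftrightarrow> (\<forall>x y. b x y = b y x)"

definition nondegenerate :: "('v::zero \<Rightarrow> 'v \<Rightarrow> 'a::zero) \<Rightarrow> bool" where
  "nondegenerate b \<longleftrightarrow> (\<forall>x. (\<forall>y. b x y = 0) \<longrightarrow> x = 0)"

definition totally_singular :: "('v \<Rightarrow> 'v \<Rightarrow> 'a::zero) \<Rightarrow> 'v set \<Rightarrow> bool" where
  "totally_singular b X \<longleftrightarrow> (\<forall>x\<in>X. \<forall>y\<in>X. b x y = 0)"

definition witt_index :: "('a::field \<Rightarrow> 'v::ab_group_add \<Rightarrow> 'v) \<Rightarrow> ('v \<Rightarrow> 'v \<Rightarrow> 'a) \<Rightarrow> nat" where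
  "witt_index scale b =
     Max {vector_space.dim scale X | X. module.subspace scale X \<and> totally_singular b X}"

definition b_symmetric :: "('a::field \<Rightarrow> 'v::ab_group_add \<Rightarrow> 'v) \<Rightarrow> ('v \<Rightarrow> 'v \<Rightarrow> 'a) \<Rightarrow> ('v \<Rightarrow> 'v) set" where
  "b_symmetric scale b =
     {u. Vector_Spaces.linear scale scale u \<and> (\<forall>x y. b x (u y) = b y (u x))}"

definition nilpotent_end :: "('v \<Rightarrow> 'v::zero) \<Rightarrow> bool" where
  "nilpotent_end u \<longleftrightarrow> (\<exists>k. (u ^^ k) = (\<lambda>_. 0))"

text \<open>A flag (F_0,...,F_p) is represented by F :: nat => 'v set together with p.\<close>
definition is_flag :: "('a::field \<Rightarrow> 'v::ab_group_add \<Rightarrow> 'v) \<Rightarrow> (nat \<Rightarrow> 'v set) \<Rightarrow> nat \<Rightarrow> bool" where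
  "is_flag scale F p \<longleftrightarrow> (\<forall>i\<le>p. module.subspace scale (F i)) \<and> (\<forall>i<p. F i \<subseteq> F (Suc i))"

definition partially_complete :: "('a::field \<Rightarrow> 'v::ab_group_add \<Rightarrow> 'v) \<Rightarrow> (nat \<Rightarrow> 'v set) \<Rightarrow> nat \<Rightarrow> bool" where
  "partially_complete scale F p \<longleftrightarrow> (\<forall>i\<le>p. vector_space.dim scale (F i) = i)"

definition b_singular_flag :: "('v \<Rightarrow> 'v \<Rightarrow> 'a::zero) \<Rightarrow> (nat \<Rightarrow> 'v set) \<Rightarrow> nat \<Rightarrow> bool" where
  "b_singular_flag b F p \<longleftrightarrow> totally_singular b (F p)"

definition maximal_pc_singular_flag ::
  "('a::field \<Rightarrow> 'v::ab_group_add \<Rightarrow> 'v) \<Rightarrow> ('v \<Rightarrow> 'v \<Rightarrow> 'a) \<Rightarrow> (nat \<Rightarrow> 'v set) \<Rightarrow> nat \<Rightarrow> bool" where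
  "maximal_pc_singular_flag scale b F p \<longleftrightarrow>
     is_flag scale F p \<and> partially_complete scale F p \<and> b_singular_flag b F p \<and> p = witt_index scale b"

definition stabilizes :: "('v \<Rightarrow> 'v) \<Rightarrow> (nat \<Rightarrow> 'v set) \<Rightarrow> nat \<Rightarrow> bool" where
  "stabilizes u F p \<longleftrightarrow> (\<forall>i\<le>p. u ` F i \<subseteq> F i)"

definition WS :: "('a::field \<Rightarrow> 'v::ab_group_add \<Rightarrow> 'v) \<Rightarrow> ('v \<Rightarrow> 'v \<Rightarrow> 'a) \<Rightarrow> (nat \<Rightarrow> 'v set) \<Rightarrow> nat \<Rightarrow> ('v \<Rightarrow> 'v) set" where
  "WS scale b F p = {u \<in> b_symmetric scale b. nilpotent_end u \<and> stabilizes u F p}"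

end

theory Submission
  imports Defs "Jordan_Normal_Form.Determinant"
begin

text \<open>
Write \<open>tens x y\<close> for the symmetric endomorphism \<open>t \<mapsto> b(y,t) x + b(x,t) y\<close>. For a nonzero
singular \<open>x\<close> let \<open>\<V>x\<close> be the orbit of \<open>x\<close> and \<open>L\<close> the space of all \<open>y \<bottom> x\<close> with
\<open>tens x y \<in> \<V>\<close>. Since \<open>L\<close> is orthogonal to \<open>\<V>x\<close> and to \<open>x \<notin> \<V>x\<close>, the sum of their dimensions
is at most \<open>n - 1\<close>; compressing the annihilator of \<open>x\<close> to \<open>x\<^sup>\<bottom>/x\<close> gives the bound \<open>\<nu>(n - \<nu>)\<close> by
induction. In case of equality, \<open>tens x y \<in> \<V>\<close> for every \<open>y\<close> orthogonal to \<open>x\<close> and \<open>\<V>x\<close>, and the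
compressed space is again of maximal dimension, so it suffices to find a singular \<open>x\<close> killed by \<open>\<V>\<close>.

The tool for this, valid over every field of characteristic not 2, is a determinant identity: if \<open>v\<close>
and \<open>v + \<Sum> w\<^sub>i f\<^sub>i\<close> are nilpotent and \<open>M\<close> is the matrix of generating polynomials
\<open>\<Sum>\<^sub>k f\<^sub>i(v\<^sup>k w\<^sub>j) X\<^sup>k\<close>, then \<open>det (1 - X M) = 1\<close>, because \<open>1 - X M\<close> has a polynomial inverse. Using
both signs of the update, it yields for instance \<open>b(x, v\<^sup>k y) = 0\<close> for all \<open>k\<close> if \<open>tens x y \<in> \<V>\<close>.

If no nonzero singular \<open>z\<close> has \<open>tens z z \<in> \<V>\<close>, then all spaces \<open>L\<close> vanish, and the elements of \<open>\<V>\<close>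
lifted from \<open>x\<^sup>\<bottom>/x\<close> violate the trace identities. Otherwise \<open>z\<close> and \<open>\<V>z\<close> span a totally singular
space all of whose vectors share the property of \<open>z\<close>; inside it one descends to a vector whose
orbit lies in a plane, then to a \<open>\<V>\<close>-stable plane, and there to a common kernel vector.
\<close>

section \<open>Determinants of finite-rank updates\<close>

lemma coeff_0_1_prod_linear:
  fixes c :: "'i \<Rightarrow> 'r::comm_ring_1"
  assumes "finite I"
  shows "coeff (\<Prod>i\<in>I. [:1, c i:]) 0 = 1 \<and> coeff (\<Prod>i\<in>I. [:1, c i:]) (Suc 0) = (\<Sum>i\<in>I. c i)"
  using assms by (induction I rule: finite_induct) (auto simp: algebra_simps)

text \<open>In the Leibniz expansion a permutation other than the identity moves at least two
  indices, so it contributes a multiple of \<open>\<mu>\<^sup>2\<close>; the identity contributes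
  the product of the \<open>1 - \<mu> * N $$ (i, i)\<close>. The remainder \<open>S\<close> does not
  depend on \<open>\<mu>\<close>, so expansions at different \<open>\<mu>\<close> can be
  compared.\<close>

lemma det_one_minus_smult:
  fixes N :: "'r::comm_ring_1 mat"
  assumes N: "N \<in> carrier_mat m m"
  obtains S :: "'r poly"
  where "\<And>\<mu>. det (1\<^sub>m m - \<mu> \<cdot>\<^sub>m N) = 1 - \<mu> * (\<Sum>i<m. N $$ (i, i)) + \<mu>\<^sup>2 * poly S \<mu>"
proof -
  \<comment> \<open>\<open>q p i\<close> is the entry of \<open>1 - \<mu> N\<close> at
    \<open>(i, p i)\<close>, viewed as a polynomial in \<open>\<mu>\<close>.\<close>
  define q where "q p i = [:if i = p i then 1 else 0, - N $$ (i, p i):]" for p :: "nat \<Rightarrow> nat" and i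
  define T where "T p = (\<Prod>i=0..<m. q p i)" for p
  define Q where "Q = (\<Sum>p | p permutes {0..<m}. signof p * T p)"
  have det: "det (1\<^sub>m m - \<mu> \<cdot>\<^sub>m N) = poly Q \<mu>" for \<mu>
  proof -
    have c: "1\<^sub>m m - \<mu> \<cdot>\<^sub>m N \<in> carrier_mat m m"
      using N by auto
    have "(\<Prod>i=0..<m. (1\<^sub>m m - \<mu> \<cdot>\<^sub>m N) $$ (i, p i)) = poly (T p) \<mu>" if p: "p permutes {0..<m}" for p
      unfolding T_def poly_prod
    proof (rule prod.cong)
      fix i assume i: "i \<in> {0..<m}"
      have "p i < m"
        using permutes_in_image[OF p, of i] i by auto
      then show "(1\<^sub>m m - \<mu> \<cdot>\<^sub>m N) $$ (i, p i) = poly (q p i) \<mu>"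
        using i N by (auto simp: q_def)
    qed simp
    then show ?thesis
      unfolding det_def'[OF c] Q_def poly_sum by (intro sum.cong) (auto simp: sign_def)
  qed
  have Tid: "coeff (T id) 0 = 1" "coeff (T id) (Suc 0) = - (\<Sum>i<m. N $$ (i, i))"
    unfolding T_def q_def using coeff_0_1_prod_linear[of "{0..<m}" "\<lambda>i. - N $$ (i, i)"]
    by (auto simp: sum_negf atLeast0LessThan)
  have Tp: "coeff (T p) 0 = 0" "coeff (T p) (Suc 0) = 0" if p: "p permutes {0..<m}" and "p \<noteq> id" for p
  proof -
    obtain i where i: "p i \<noteq> i"
      using \<open>p \<noteq> id\<close> by (auto simp: fun_eq_iff)
    define j where "j = p i"
    have "inj p" using p by (rule permutes_inj)
    then have j: "p j \<noteq> j" using i by (auto simp: j_def dest: injD)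
    have im: "i \<in> {0..<m}" using i p by (auto simp: permutes_def)
    have jm: "j \<in> {0..<m}" using j p by (auto simp: permutes_def)
    have "i \<noteq> j" using i by (simp add: j_def)
    \<comment> \<open>Since \<open>p\<close> moves both \<open>i\<close> and \<open>j\<close>, the
      two extracted factors have constant coefficient zero.\<close>
    have "T p = q p i * (q p j * (\<Prod>k\<in>{0..<m} - {i} - {j}. q p k))"
      unfolding T_def using im jm \<open>i \<noteq> j\<close>
      by (subst prod.remove[of _ i], simp, simp, subst prod.remove[of _ j]) auto
    then show "coeff (T p) 0 = 0" "coeff (T p) (Suc 0) = 0"
      using i j by (auto simp: q_def coeff_pCons)
  qed
  have fin: "finite {p. p permutes {0..<m}}" by (rule finite_permutations) simp
  have idp: "id \<in> {p. p permutes {0..<m}}" by (simp add: permutes_id)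
  have cs: "coeff (signof p * T p) k = signof p * coeff (T p) k" for p k
    by (simp add: sign_def)
  have C: "coeff Q k = coeff (T id) k" if k: "k = 0 \<or> k = Suc 0" for k
  proof -
    have "coeff Q k = (\<Sum>p | p permutes {0..<m}. signof p * coeff (T p) k)"
      unfolding Q_def coeff_sum cs ..
    also have "\<dots> = signof id * coeff (T id) k"
    proof -
      have "(\<Sum>p\<in>{p. p permutes {0..<m}} - {id}. signof p * coeff (T p) k) = 0"
      proof (intro sum.neutral ballI)
        fix p assume "p \<in> {p. p permutes {0..<m}} - {id}"
        then have "p permutes {0..<m}" "p \<noteq> id" by blast+
        from Tp[OF this] k show "signof p * coeff (T p) k = 0" by auto
      qed
      then show ?thesis by (subst sum.remove[OF fin idp]) simp
    qed
    finally show ?thesis by simp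
  qed
  obtain a0 a1 S where Q: "Q = pCons a0 (pCons a1 S)"
    by (metis pCons_cases)
  have "a0 = 1" "a1 = - (\<Sum>i<m. N $$ (i, i))"
    using C[of 0] C[of "Suc 0"] Tid by (auto simp: Q)
  then have "det (1\<^sub>m m - \<mu> \<cdot>\<^sub>m N) = 1 - \<mu> * (\<Sum>i<m. N $$ (i, i)) + \<mu>\<^sup>2 * poly S \<mu>" for \<mu>
    unfolding det Q by (simp add: algebra_simps power2_eq_square)
  then show thesis by (rule that)
qed

text \<open>Even powers of \<open>t\<close> cancel in the difference. At \<open>t = X\<close> this
  makes the quadratic remainders of \<open>det (1 - X M)\<close> and \<open>det (1 + X M)\<close>
  differ by a multiple of \<open>X^3\<close>.\<close>

lemma poly_odd_part_dvd:
  fixes t :: "'r::comm_ring_1"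
  shows "\<exists>k. poly S t - poly S (- t) = t * k"
proof (induction S)
  case (pCons a S)
  have "poly (pCons a S) t - poly (pCons a S) (- t) = t * (poly S t + poly S (- t))"
    by (simp add: algebra_simps)
  then show ?case by blast
qed (auto intro: exI[of _ 0])

lemma coeff_mult_small:
  fixes p q :: "'c::comm_ring_1 poly"
  shows "coeff (p * q) 1 = coeff p 0 * coeff q 1 + coeff p 1 * coeff q 0"
    "coeff (p * q) 2 = coeff p 0 * coeff q 2 + coeff p 1 * coeff q 1 + coeff p 2 * coeff q 0"
  by (simp_all add: coeff_mult numeral_2_eq_2)

lemma sum_four: "(\<Sum>i<4. H i) = H 0 + H 1 + H 2 + (H (3::nat) :: 'c::comm_monoid_add)"
  by (simp add: eval_nat_numeral add.assoc)

text \<open>A unit of the polynomial ring over a field has degree zero.\<close>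

lemma one_plus_X_mult_unit_imp_zero:
  fixes p q :: "'a::field poly"
  assumes "(1 + [:0, 1:] * p) * q = 1"
  shows "p = 0"
proof (rule ccontr)
  assume "p \<noteq> 0"
  have "1 + [:0, 1:] * p = pCons 1 p" by (simp add: one_pCons)
  moreover have "degree (pCons 1 p) = Suc (degree p)"
    using \<open>p \<noteq> 0\<close> by simp
  moreover have "q \<noteq> 0" using assms by auto
  moreover have "degree (pCons 1 p * q) = 0"
    using assms calculation(1) by simp
  ultimately show False
    by (metis add_is_0 degree_0 degree_mult_eq nat.distinct(1))
qed

text \<open>The hypotheses say \<open>M' = M + A M' M\<close> for the matrices with rows
  \<open>(p, q), (r, s)\<close> and \<open>(P, Q), (R, S)\<close>. Hence
  \<open>(1 + A M') (1 - A M) = 1\<close>, and the determinant is multiplicative.\<close>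

lemma det_two_resolvent:
  fixes p q r s P Q R S A :: "'r::comm_ring_1"
  assumes "P = p + A * (P * p + Q * r)" "Q = q + A * (P * q + Q * s)"
    "R = r + A * (R * p + S * r)" "S = s + A * (R * q + S * s)"
  shows "((1 - A * p) * (1 - A * s) - A * A * q * r) * ((1 + A * P) * (1 + A * S) - A * A * Q * R) = 1"
proof -
  have z: "P - p - A * (P * p + Q * r) = 0" "Q - q - A * (P * q + Q * s) = 0"
    "R - r - A * (R * p + S * r) = 0" "S - s - A * (R * q + S * s) = 0"
    using assms by (simp_all only: right_minus_eq diff_diff_eq)
  have k: "(1 + A*P) * (1 - A*p) - A*Q*(A*r) = 1 + A * (P - p - A * (P * p + Q * r))"
    "A*Q*(1 - A*s) - (1 + A*P) * (A*q) = A * (Q - q - A * (P * q + Q * s))"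
    "A*R*(1 - A*p) - (1 + A*S)*(A*r) = A * (R - r - A * (R * p + S * r))"
    "(1 + A*S)*(1 - A*s) - A*R*(A*q) = 1 + A * (S - s - A * (R * q + S * s))"
    by (simp_all add: algebra_simps)
  have "((1 - A * p) * (1 - A * s) - A * A * q * r) * ((1 + A * P) * (1 + A * S) - A * A * Q * R) =
    ((1 + A*P) * (1 - A*p) - A*Q*(A*r)) * ((1 + A*S)*(1 - A*s) - A*R*(A*q))
    - (A*Q*(1 - A*s) - (1 + A*P) * (A*q)) * (A*R*(1 - A*p) - (1 + A*S)*(A*r))"
    by (simp add: algebra_simps)
  then show ?thesis unfolding k z by simp
qed

section \<open>Generating polynomials of moments and their change under finite-rank updates\<close>

text \<open>\<open>Abs_poly\<close> has its intended meaning only if finitely many moments are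
  nonzero, which nilpotency of \<open>v\<close> guarantees.\<close>

definition moment_poly :: "('v \<Rightarrow> 'a::field) \<Rightarrow> ('v \<Rightarrow> 'v) \<Rightarrow> 'v \<Rightarrow> 'a poly" where
  "moment_poly f v y = Abs_poly (\<lambda>k. f ((v ^^ k) y))"

context vector_space
begin

lemma linear_funpow:
  assumes "Vector_Spaces.linear scale scale v"
  shows "Vector_Spaces.linear scale scale (v ^^ k)"
  using assms by (induction k) (auto simp: Vector_Spaces.linear_iff)

lemma linear_functional_iff:
  "Vector_Spaces.linear scale (*) f \<longleftrightarrow>
    (\<forall>x y. f (x + y) = f x + f y) \<and> (\<forall>c x. f (c *s x) = c * f x)"
  unfolding Vector_Spaces.linear_iff
  using vector_space_axioms by (auto intro!: vector_space.intro simp: algebra_simps)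

lemma nilpotent_funpow_zero:
  fixes v :: "'b \<Rightarrow> 'b"
  assumes "(v ^^ K) = (\<lambda>_. 0)" "K \<le> k"
  shows "(v ^^ k) y = 0"
proof -
  have "v ^^ k = (v ^^ K) \<circ> (v ^^ (k - K))"
    using assms(2) by (metis funpow_add le_add_diff_inverse)
  then show ?thesis using assms(1) by simp
qed

lemma coeff_moment_poly [simp]:
  assumes "nilpotent_end v" "Vector_Spaces.linear scale (*) f"
  shows "coeff (moment_poly f v y) k = f ((v ^^ k) y)"
proof -
  obtain K where K: "(v ^^ K) = (\<lambda>_. 0)"
    using assms(1) by (auto simp: nilpotent_end_def)
  interpret f: Vector_Spaces.linear scale "(*)" f by fact
  show ?thesis
    unfolding moment_poly_def
    by (subst coeff_Abs_poly[of K]) (simp_all add: nilpotent_funpow_zero[OF K])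
qed

text \<open>Telescoping: \<open>v'^k - v^k\<close> is the sum of the
  \<open>v'^(k-1-q) (v' - v) v^q\<close>. The update formula is evaluated only at vectors
  \<open>v^q c\<close>, so it is required only on a \<open>v\<close>-stable set
  \<open>C\<close>.\<close>

lemma funpow_finite_rank_update:
  fixes m :: nat
  assumes v': "Vector_Spaces.linear scale scale v'"
    and C: "\<And>c. c \<in> C \<Longrightarrow> v c \<in> C"
    and upd: "\<And>c. c \<in> C \<Longrightarrow> v' c = v c + (\<Sum>l<m. f l c *s w l)"
    and "c \<in> C"
  shows "(v' ^^ k) c = (v ^^ k) c + (\<Sum>q<k. \<Sum>l<m. f l ((v ^^ q) c) *s (v' ^^ (k - Suc q)) (w l))"
  using \<open>c \<in> C\<close>
proof (induction k arbitrary: c)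
  case (Suc k)
  interpret vk: Vector_Spaces.linear scale scale "v' ^^ k" by (rule linear_funpow[OF v'])
  have "(v' ^^ Suc k) c = (v' ^^ k) (v c + (\<Sum>l<m. f l c *s w l))"
    by (simp add: funpow_Suc_right upd Suc.prems del: funpow.simps)
  also have "\<dots> = (v' ^^ k) (v c) + (\<Sum>l<m. f l c *s (v' ^^ k) (w l))"
    by (simp add: vk.add vk.sum vk.scale)
  also have "\<dots> = (v ^^ Suc k) c
      + ((\<Sum>l<m. f l c *s (v' ^^ k) (w l))
        + (\<Sum>q<k. \<Sum>l<m. f l ((v ^^ Suc q) c) *s (v' ^^ (k - Suc q)) (w l)))"
    by (simp add: Suc.IH[OF C[OF Suc.prems]] funpow_Suc_right del: funpow.simps)
  finally show ?case
    by (simp add: sum.lessThan_Suc_shift del: sum.lessThan_Suc funpow.simps)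
qed simp

text \<open>The convolution in \<open>funpow_finite_rank_update\<close> becomes a product of
  polynomials; the factor \<open>X\<close> accounts for the one application of
  \<open>v' - v\<close>.\<close>

lemma moment_poly_finite_rank_update:
  fixes m :: nat
  assumes v': "Vector_Spaces.linear scale scale v'"
    and nil: "nilpotent_end v" "nilpotent_end v'"
    and f: "\<And>l. l < m \<Longrightarrow> Vector_Spaces.linear scale (*) (f l)"
    and C: "\<And>c. c \<in> C \<Longrightarrow> v c \<in> C"
    and upd: "\<And>c. c \<in> C \<Longrightarrow> v' c = v c + (\<Sum>l<m. f l c *s w l)"
    and g: "Vector_Spaces.linear scale (*) g" and "c \<in> C"
  shows "moment_poly g v' c =
    moment_poly g v c + [:0, 1:] * (\<Sum>l<m. moment_poly g v' (w l) * moment_poly (f l) v c)"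
proof (rule poly_eqI)
  fix k
  interpret g: Vector_Spaces.linear scale "(*)" g by fact
  have "g ((v' ^^ k) c) = g ((v ^^ k) c)
      + (\<Sum>q<k. \<Sum>l<m. g ((v' ^^ (k - Suc q)) (w l)) * f l ((v ^^ q) c))"
    by (simp add: funpow_finite_rank_update[where v = v and C = C and f = f and w = w, OF v' C upd \<open>c \<in> C\<close>]
        g.add g.sum g.scale mult.commute)
  also have "(\<Sum>q<k. \<Sum>l<m. g ((v' ^^ (k - Suc q)) (w l)) * f l ((v ^^ q) c)) =
      coeff ([:0, 1:] * (\<Sum>l<m. moment_poly g v' (w l) * moment_poly (f l) v c)) k"
  proof (cases k)
    case (Suc j)
    have "coeff ([:0, 1:] * (\<Sum>l<m. moment_poly g v' (w l) * moment_poly (f l) v c)) k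
        = (\<Sum>l<m. coeff (moment_poly (f l) v c * moment_poly g v' (w l)) j)"
      by (simp add: Suc coeff_sum mult.commute)
    also have "\<dots> = (\<Sum>l<m. \<Sum>q\<le>j. f l ((v ^^ q) c) * g ((v' ^^ (j - q)) (w l)))"
      by (intro sum.cong) (auto simp: coeff_mult nil f g)
    also have "\<dots> = (\<Sum>q\<le>j. \<Sum>l<m. f l ((v ^^ q) c) * g ((v' ^^ (j - q)) (w l)))"
      by (rule sum.swap)
    finally show ?thesis
      by (simp add: Suc lessThan_Suc_atMost mult.commute)
  qed simp
  finally show "coeff (moment_poly g v' c) k =
      coeff (moment_poly g v c + [:0, 1:] * (\<Sum>l<m. moment_poly g v' (w l) * moment_poly (f l) v c)) k"
    by (simp add: nil g)
qed

text \<open>With \<open>M\<close> the 2 by 2 matrix of moment polynomials, the two signs of the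
  update give \<open>1 - X tr M + X^2 det M = 1\<close> and
  \<open>1 + X tr M + X^2 det M = 1\<close>. Subtracting gives trace zero, and then the determinant
  is zero. The set \<open>C\<close> admits updates that have rank two only on a stable
  subset.\<close>

lemma rank_two_update:
  assumes v': "Vector_Spaces.linear scale scale v'" "Vector_Spaces.linear scale scale v''"
    and nil: "nilpotent_end v" "nilpotent_end v'" "nilpotent_end v''"
    and two: "(2::'a) \<noteq> 0"
    and f: "Vector_Spaces.linear scale (*) f" and g: "Vector_Spaces.linear scale (*) g"
    and C: "\<And>c. c \<in> C \<Longrightarrow> v c \<in> C"
    and upd': "\<And>c. c \<in> C \<Longrightarrow> v' c = v c + (f c *s x + g c *s y)"
    and upd'': "\<And>c. c \<in> C \<Longrightarrow> v'' c = v c - (f c *s x + g c *s y)"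
    and xy: "x \<in> C" "y \<in> C"
  shows "moment_poly f v x + moment_poly g v y = 0"
    and "moment_poly f v x * moment_poly g v y = moment_poly f v y * moment_poly g v x"
proof -
  let ?p = "moment_poly f v x" and ?q = "moment_poly f v y"
    and ?r = "moment_poly g v x" and ?s = "moment_poly g v y" and ?X = "[:0, 1::'a:]"
  \<comment> \<open>One computation serves both signs: \<open>h\<close> is \<open>v'\<close> or
    \<open>v''\<close>, \<open>\<epsilon>\<close> is the sign, and \<open>e\<close> is the constant
    polynomial with that value.\<close>
  have *: "1 - e * (?p + ?s) * ?X + ?X^2 * (?p * ?s - ?q * ?r) = 1"
    if lin: "Vector_Spaces.linear scale scale h" and nh: "nilpotent_end h"
      and upd: "\<And>c. c \<in> C \<Longrightarrow> h c = v c + (\<epsilon> * f c) *s x + (\<epsilon> * g c) *s y"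
      and eps: "e = [:\<epsilon>:]" "\<epsilon> * \<epsilon> = 1" for h \<epsilon> e
  proof -
    define F where "F l = (\<lambda>c. \<epsilon> * (if l = 0 then f c else g c))" for l :: nat
    define w where "w l = (if l = 0 then x else y)" for l :: nat
    have scl: "Vector_Spaces.linear scale (*) (\<lambda>c. \<epsilon> * f c)" "Vector_Spaces.linear scale (*) (\<lambda>c. \<epsilon> * g c)"
      using f g unfolding linear_functional_iff by (auto simp: algebra_simps)
    have mp: "moment_poly (\<lambda>c. \<epsilon> * f c) v u = e * moment_poly f v u"
      "moment_poly (\<lambda>c. \<epsilon> * g c) v u = e * moment_poly g v u" for u
      by (rule poly_eqI; simp add: nil f g scl eps)+
    have two_sum: "(\<Sum>l<2. H l) = H 0 + H 1" for H :: "nat \<Rightarrow> 'c::comm_monoid_add"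
      by (simp add: numeral_2_eq_2)
    have rec: "moment_poly d h u = moment_poly d v u +
        ?X * (e * (moment_poly d h x * moment_poly f v u + moment_poly d h y * moment_poly g v u))"
      if d: "Vector_Spaces.linear scale (*) d" and "u \<in> C" for d u
    proof -
      have "moment_poly d h u = moment_poly d v u
          + ?X * (\<Sum>l<2. moment_poly d h (w l) * moment_poly (F l) v u)"
      proof (rule moment_poly_finite_rank_update[OF lin nil(1) nh _ C _ d \<open>u \<in> C\<close>])
        show "Vector_Spaces.linear scale (*) (F l)" for l
          unfolding F_def using scl by (cases "l = 0") auto
        show "h c = v c + (\<Sum>l<2. F l c *s w l)" if "c \<in> C" for c
          by (simp add: two_sum upd[OF that] F_def w_def)
      qed
      then show ?thesis
        by (simp add: two_sum F_def w_def mp algebra_simps)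
    qed
    let ?P = "moment_poly f h x" and ?Q = "moment_poly f h y"
      and ?R = "moment_poly g h x" and ?S = "moment_poly g h y"
    have e2: "e * e = 1" using eps by (simp add: one_pCons)
    have r: "?P = ?p + ?X * e * (?P * ?p + ?Q * ?r)" "?Q = ?q + ?X * e * (?P * ?q + ?Q * ?s)"
      "?R = ?r + ?X * e * (?R * ?p + ?S * ?r)" "?S = ?s + ?X * e * (?R * ?q + ?S * ?s)"
      using rec[OF f xy(1)] rec[OF f xy(2)] rec[OF g xy(1)] rec[OF g xy(2)]
      unfolding mult.assoc .
    define A where "A = ?X * e"
    define D where "D = (1 - A * ?p) * (1 - A * ?s) - A * A * ?q * ?r"
    define D' where "D' = (1 + A * ?P) * (1 + A * ?S) - A * A * ?Q * ?R"
    have "D * D' = 1"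
      unfolding D_def D'_def by (rule det_two_resolvent[OF r[folded A_def]])
    moreover have "D = 1 + ?X * (?X * (?p * ?s - ?q * ?r) - e * (?p + ?s))"
    proof -
      have ring: "(1 - t*c*a1) * (1 - t*c*a4) - t*c*(t*c)*a2*a3
          = 1 + t * (t * ((c*c) * (a1*a4 - a2*a3)) - c * (a1+a4))" for t c a1 a2 a3 a4 :: "'a poly"
        by (simp add: algebra_simps)
      show ?thesis unfolding D_def A_def ring e2 by simp
    qed
    ultimately have "?X * (?p * ?s - ?q * ?r) - e * (?p + ?s) = 0"
      using one_plus_X_mult_unit_imp_zero[of "?X * (?p * ?s - ?q * ?r) - e * (?p + ?s)" D'] by simp
    moreover have ring: "1 - c * a * t + t^2 * d = 1 + t * (t * d - c * a)" for a t c d :: "'a poly"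
      by (simp add: algebra_simps power2_eq_square)
    ultimately show ?thesis unfolding ring by (simp del: mult_pCons_left)
  qed
  have plus: "1 - 1 * (?p + ?s) * ?X + ?X^2 * (?p * ?s - ?q * ?r) = 1"
    by (rule *[OF v'(1) nil(2), where \<epsilon> = 1]) (auto simp: upd' one_pCons add.assoc)
  have minus: "1 - (-1) * (?p + ?s) * ?X + ?X^2 * (?p * ?s - ?q * ?r) = 1"
    by (rule *[OF v'(2) nil(3), where \<epsilon> = "-1"]) (auto simp: upd'' one_pCons algebra_simps)
  have "[:2:] * (?X * (?p + ?s)) = 0"
  proof -
    have ring: "2 * (t * a) = (1 - (-1) * a * t + d) - (1 - 1 * a * t + d)" for t a d :: "'a poly"
      by (simp add: algebra_simps)
    have "2 * (?X * (?p + ?s)) = 0" unfolding ring[of _ _ "?X^2 * (?p * ?s - ?q * ?r)"] plus minus by simp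
    then show ?thesis by (simp add: numeral_poly)
  qed
  then show 1: "?p + ?s = 0" using two by simp
  have "?X^2 * (?p * ?s - ?q * ?r) = 0"
    using plus by (simp add: 1)
  then show "?p * ?s = ?q * ?r" by simp
qed

text \<open>The moment matrices of \<open>v\<close> and \<open>v'\<close> satisfy
  \<open>(1 + X M') (1 - X M) = 1\<close>. So \<open>det (1 - X M)\<close> is a polynomial unit,
  hence constant, and its constant term is 1.\<close>

lemma det_finite_rank_update:
  fixes m :: nat
  assumes v': "Vector_Spaces.linear scale scale v'"
    and nil: "nilpotent_end v" "nilpotent_end v'"
    and f: "\<And>l. l < m \<Longrightarrow> Vector_Spaces.linear scale (*) (f l)"
    and upd: "\<And>c. v' c = v c + (\<Sum>l<m. f l c *s w l)"
  shows "det (1\<^sub>m m - [:0, 1:] \<cdot>\<^sub>m mat m m (\<lambda>(i, j). moment_poly (f i) v (w j))) = 1"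
proof -
  let ?X = "[:0, 1::'a:]"
  define M where "M = mat m m (\<lambda>(i, j). moment_poly (f i) v (w j))"
  define M' where "M' = mat m m (\<lambda>(i, j). moment_poly (f i) v' (w j))"
  have carrier: "M \<in> carrier_mat m m" "M' \<in> carrier_mat m m"
    by (auto simp: M_def M'_def)
  have prod: "(1\<^sub>m m + ?X \<cdot>\<^sub>m M') * (1\<^sub>m m - ?X \<cdot>\<^sub>m M) = 1\<^sub>m m"
  proof -
    have rec: "M' = M + ?X \<cdot>\<^sub>m (M' * M)"
    proof (rule eq_matI)
      fix i j assume "i < dim_row (M + ?X \<cdot>\<^sub>m (M' * M))" "j < dim_col (M + ?X \<cdot>\<^sub>m (M' * M))"
      then have ij: "i < m" "j < m" by (auto simp: M_def M'_def)
      have "M' $$ (i, j) = moment_poly (f i) v (w j)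
          + ?X * (\<Sum>l<m. moment_poly (f i) v' (w l) * moment_poly (f l) v (w j))"
        unfolding M'_def using ij
        by (simp add: moment_poly_finite_rank_update[where v = v and C = UNIV and f = f and w = w
              and m = m and g = "f i" and c = "w j", OF v' nil] f upd del: mult_pCons_left)
      also have "\<dots> = (M + ?X \<cdot>\<^sub>m (M' * M)) $$ (i, j)"
        using ij by (simp add: M_def M'_def scalar_prod_def atLeast0LessThan)
      finally show "M' $$ (i, j) = (M + ?X \<cdot>\<^sub>m (M' * M)) $$ (i, j)" .
    qed (auto simp: M_def M'_def)
    have "(1\<^sub>m m + ?X \<cdot>\<^sub>m M') * (1\<^sub>m m - ?X \<cdot>\<^sub>m M)
        = (1\<^sub>m m - ?X \<cdot>\<^sub>m M) + ?X \<cdot>\<^sub>m M' * (1\<^sub>m m - ?X \<cdot>\<^sub>m M)"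
      using carrier by (subst add_mult_distrib_mat[of _ m m]) auto
    also have "?X \<cdot>\<^sub>m M' * (1\<^sub>m m - ?X \<cdot>\<^sub>m M) = ?X \<cdot>\<^sub>m M' - ?X \<cdot>\<^sub>m M' * (?X \<cdot>\<^sub>m M)"
      using carrier by (subst mult_minus_distrib_mat[of _ m m]) auto
    also have "?X \<cdot>\<^sub>m M' * (?X \<cdot>\<^sub>m M) = ?X \<cdot>\<^sub>m (?X \<cdot>\<^sub>m (M' * M))"
      using carrier
      by (metis mult_smult_assoc_mat mult_smult_distrib smult_carrier_mat)
    also have "(1\<^sub>m m - ?X \<cdot>\<^sub>m M) + (?X \<cdot>\<^sub>m M' - ?X \<cdot>\<^sub>m (?X \<cdot>\<^sub>m (M' * M))) = 1\<^sub>m m"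
    proof (rule eq_matI)
      fix i j assume "i < dim_row (1\<^sub>m m :: 'a poly mat)" "j < dim_col (1\<^sub>m m :: 'a poly mat)"
      then have ij: "i < m" "j < m" by auto
      have "M' $$ (i, j) = M $$ (i, j) + ?X * (M' * M) $$ (i, j)"
        using ij carrier arg_cong[OF rec, of "\<lambda>A. A $$ (i, j)"] by (simp del: index_mult_mat(1))
      then have "?X * M' $$ (i, j) - ?X * (?X * (M' * M) $$ (i, j)) = ?X * M $$ (i, j)"
        by (simp only: distrib_left add_diff_cancel_right')
      then show "((1\<^sub>m m - ?X \<cdot>\<^sub>m M) + (?X \<cdot>\<^sub>m M' - ?X \<cdot>\<^sub>m (?X \<cdot>\<^sub>m (M' * M)))) $$ (i, j) = 1\<^sub>m m $$ (i, j)"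
        using ij carrier by (simp del: index_mult_mat(1) mult_pCons_left)
    qed (use carrier in auto)
    finally show ?thesis .
  qed
  have "det (1\<^sub>m m + ?X \<cdot>\<^sub>m M') * det (1\<^sub>m m - ?X \<cdot>\<^sub>m M) = 1"
    using carrier prod by (subst det_mult[symmetric, of _ m]) auto
  moreover obtain S where S: "\<And>\<mu>. det (1\<^sub>m m - \<mu> \<cdot>\<^sub>m M) = 1 - \<mu> * (\<Sum>i<m. M $$ (i, i)) + \<mu>\<^sup>2 * poly S \<mu>"
    using det_one_minus_smult[OF carrier(1)] by blast
  moreover have S': "1 - ?X * (\<Sum>i<m. M $$ (i, i)) + ?X\<^sup>2 * poly S ?X
      = 1 + ?X * (?X * poly S ?X - (\<Sum>i<m. M $$ (i, i)))"
    by (simp add: algebra_simps power2_eq_square del: mult_pCons_left)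
  ultimately have "?X * poly S ?X - (\<Sum>i<m. M $$ (i, i)) = 0"
    using one_plus_X_mult_unit_imp_zero[of _ "det (1\<^sub>m m + ?X \<cdot>\<^sub>m M')"] by (simp only: mult.commute)
  then have "det (1\<^sub>m m - ?X \<cdot>\<^sub>m M) = 1"
    unfolding S S' by simp
  then show ?thesis by (simp only: M_def)
qed

text \<open>Both \<open>det (1 - X M)\<close> and \<open>det (1 + X M)\<close> equal 1. Their
  difference shows that \<open>X^2\<close> divides \<open>tr M\<close>; their product,
  \<open>det (1 - X^2 M^2) = 1\<close>, shows that \<open>X^2\<close> divides
  \<open>tr (M^2)\<close>. The conclusions read off the coefficients of \<open>X\<close>, the second
  one up to a factor 2.\<close>

lemma finite_rank_trace_identities:
  fixes m :: nat
  assumes two: "(2::'a) \<noteq> 0"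
    and v': "Vector_Spaces.linear scale scale v'" "Vector_Spaces.linear scale scale v''"
    and nil: "nilpotent_end v" "nilpotent_end v'" "nilpotent_end v''"
    and f: "\<And>l. l < m \<Longrightarrow> Vector_Spaces.linear scale (*) (f l)"
    and upd': "\<And>c. v' c = v c + (\<Sum>l<m. f l c *s w l)"
    and upd'': "\<And>c. v'' c = v c - (\<Sum>l<m. f l c *s w l)"
  shows "(\<Sum>i<m. f i (v (w i))) = 0"
    and "(\<Sum>i<m. \<Sum>j<m. f i (w j) * f j (v (w i))) = 0"
proof -
  let ?X = "[:0, 1::'a:]"
  define M where "M = mat m m (\<lambda>(i, j). moment_poly (f i) v (w j))"
  have carrier: "M \<in> carrier_mat m m" by (auto simp: M_def)
  have plus: "det (1\<^sub>m m - ?X \<cdot>\<^sub>m M) = 1"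
    unfolding M_def by (rule det_finite_rank_update[OF v'(1) nil(1,2) f upd'])
  have neg: "Vector_Spaces.linear scale (*) (\<lambda>c. - f l c)" if "l < m" for l
    using f[OF that] by (auto simp: linear_functional_iff)
  have "- ?X \<cdot>\<^sub>m M = ?X \<cdot>\<^sub>m mat m m (\<lambda>(i, j). moment_poly (\<lambda>c. - f i c) v (w j))"
  proof (rule eq_matI; (simp add: M_def; fail)?)
    fix i j assume "i < dim_row (?X \<cdot>\<^sub>m mat m m (\<lambda>(i, j). moment_poly (\<lambda>c. - f i c) v (w j)))"
      "j < dim_col (?X \<cdot>\<^sub>m mat m m (\<lambda>(i, j). moment_poly (\<lambda>c. - f i c) v (w j)))"
    then have ij: "i < m" "j < m" by auto
    have "moment_poly (\<lambda>c. - f i c) v (w j) = - moment_poly (f i) v (w j)"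
      by (rule poly_eqI) (simp add: nil f neg ij)
    then show "(- ?X \<cdot>\<^sub>m M) $$ (i, j)
        = (?X \<cdot>\<^sub>m mat m m (\<lambda>(i, j). moment_poly (\<lambda>c. - f i c) v (w j))) $$ (i, j)"
      using ij by (simp add: M_def)
  qed
  moreover have "det (1\<^sub>m m - ?X \<cdot>\<^sub>m mat m m (\<lambda>(i, j). moment_poly (\<lambda>c. - f i c) v (w j))) = 1"
    by (rule det_finite_rank_update[OF v'(2) nil(1,3) neg]) (simp_all add: upd'' sum_negf)
  ultimately have minus: "det (1\<^sub>m m - (- ?X) \<cdot>\<^sub>m M) = 1" by simp
  obtain S where S: "\<And>\<mu>. det (1\<^sub>m m - \<mu> \<cdot>\<^sub>m M) = 1 - \<mu> * (\<Sum>i<m. M $$ (i, i)) + \<mu>\<^sup>2 * poly S \<mu>"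
    using det_one_minus_smult[OF carrier] by blast
  obtain k where k: "poly S ?X - poly S (- ?X) = ?X * k"
    using poly_odd_part_dvd by blast
  have "2 * (?X * (\<Sum>i<m. M $$ (i, i))) = ?X * (?X * (?X * k))"
  proof -
    have ring: "2 * (t * a) = (1 - (- t) * a + (- t)\<^sup>2 * s') - (1 - t * a + t\<^sup>2 * s) + t * (t * (s - s'))"
      for t a s s' :: "'a poly"
      by (simp add: algebra_simps power2_eq_square)
    show ?thesis
      unfolding ring[of _ _ "poly S (- ?X)" "poly S ?X"] S[symmetric] plus minus k by simp
  qed
  then have "?X * (2 * (\<Sum>i<m. M $$ (i, i)) - ?X * (?X * k)) = 0"
    by (simp add: algebra_simps del: mult_pCons_left)
  then have "2 * (\<Sum>i<m. M $$ (i, i)) = ?X * (?X * k)" by simp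
  then have "coeff (2 * (\<Sum>i<m. M $$ (i, i))) 1 = 0" by simp
  then have "2 * (\<Sum>i<m. coeff (M $$ (i, i)) 1) = 0"
    by (simp add: coeff_sum numeral_poly)
  then show "(\<Sum>i<m. f i (v (w i))) = 0"
    using two by (simp add: M_def nil f)
  have "(1\<^sub>m m - ?X \<cdot>\<^sub>m M) * (1\<^sub>m m - (- ?X) \<cdot>\<^sub>m M) = 1\<^sub>m m - ?X\<^sup>2 \<cdot>\<^sub>m (M * M)"
  proof -
    have "1\<^sub>m m - (- ?X) \<cdot>\<^sub>m M = 1\<^sub>m m + ?X \<cdot>\<^sub>m M"
      using carrier by (intro eq_matI) auto
    then have "(1\<^sub>m m - ?X \<cdot>\<^sub>m M) * (1\<^sub>m m - (- ?X) \<cdot>\<^sub>m M)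
        = (1\<^sub>m m + ?X \<cdot>\<^sub>m M) - ?X \<cdot>\<^sub>m M * (1\<^sub>m m + ?X \<cdot>\<^sub>m M)"
      using carrier minus_mult_distrib_mat[of "1\<^sub>m m" m m "?X \<cdot>\<^sub>m M" "1\<^sub>m m + ?X \<cdot>\<^sub>m M" m]
      by simp
    also have "?X \<cdot>\<^sub>m M * (1\<^sub>m m + ?X \<cdot>\<^sub>m M) = ?X \<cdot>\<^sub>m M + ?X \<cdot>\<^sub>m M * (?X \<cdot>\<^sub>m M)"
      using carrier by (subst mult_add_distrib_mat[of _ m m]) auto
    also have "?X \<cdot>\<^sub>m M * (?X \<cdot>\<^sub>m M) = ?X \<cdot>\<^sub>m (?X \<cdot>\<^sub>m (M * M))"
      using carrier
      by (metis mult_smult_assoc_mat mult_smult_distrib smult_carrier_mat)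
    also have "(1\<^sub>m m + ?X \<cdot>\<^sub>m M) - (?X \<cdot>\<^sub>m M + ?X \<cdot>\<^sub>m (?X \<cdot>\<^sub>m (M * M))) = 1\<^sub>m m - ?X\<^sup>2 \<cdot>\<^sub>m (M * M)"
    proof -
      have "(1\<^sub>m m + t \<cdot>\<^sub>m M) - (t \<cdot>\<^sub>m M + t \<cdot>\<^sub>m (t \<cdot>\<^sub>m N)) = 1\<^sub>m m - t\<^sup>2 \<cdot>\<^sub>m N"
        if "N \<in> carrier_mat m m" for t N
        using carrier that by (intro eq_matI) (auto simp: power2_eq_square algebra_simps)
      then show ?thesis using carrier by simp
    qed
    finally show ?thesis .
  qed
  then have one: "det (1\<^sub>m m - ?X\<^sup>2 \<cdot>\<^sub>m (M * M)) = 1"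
    using carrier plus minus by (metis det_mult minus_carrier_mat mult_1 smult_carrier_mat)
  have MM: "M * M \<in> carrier_mat m m" using carrier by simp
  obtain T where T: "\<And>\<mu>. det (1\<^sub>m m - \<mu> \<cdot>\<^sub>m (M * M)) = 1 - \<mu> * (\<Sum>i<m. (M * M) $$ (i, i)) + \<mu>\<^sup>2 * poly T \<mu>"
    using det_one_minus_smult[OF MM] by blast
  have "?X\<^sup>2 * (?X\<^sup>2 * poly T (?X\<^sup>2) - (\<Sum>i<m. (M * M) $$ (i, i))) = 0"
  proof -
    have ring: "t * (t * s - a) = (1 - t * a + t\<^sup>2 * s) - 1" for t s a :: "'a poly"
      by (simp add: algebra_simps power2_eq_square)
    show ?thesis unfolding ring T[symmetric] one by simp
  qed
  then have "(\<Sum>i<m. (M * M) $$ (i, i)) = ?X * (?X * poly T (?X\<^sup>2))"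
    by (subst (asm) mult_eq_0_iff, subst (asm) power2_eq_square) (simp add: power2_eq_square)
  then have "coeff (\<Sum>i<m. (M * M) $$ (i, i)) 1 = 0" by simp
  moreover have "coeff ((M * M) $$ (i, i)) 1 = (\<Sum>j<m. f i (w j) * f j (v (w i))) + (\<Sum>j<m. f j (w i) * f i (v (w j)))"
    if "i < m" for i
    using that carrier
    by (simp add: M_def scalar_prod_def coeff_sum coeff_mult nil f atLeast0LessThan sum.distrib mult.commute)
  ultimately have "(\<Sum>i<m. \<Sum>j<m. f i (w j) * f j (v (w i))) + (\<Sum>i<m. \<Sum>j<m. f j (w i) * f i (v (w j))) = 0"
    by (simp add: coeff_sum sum.distrib)
  \<comment> \<open>Exchanging \<open>i\<close> and \<open>j\<close> identifies the two halves of
    the coefficient.\<close>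
  moreover have "(\<Sum>i<m. \<Sum>j<m. f j (w i) * f i (v (w j))) = (\<Sum>i<m. \<Sum>j<m. f i (w j) * f j (v (w i)))"
    by (rule sum.swap)
  ultimately have "2 * (\<Sum>i<m. \<Sum>j<m. f i (w j) * f j (v (w i))) = 0" by simp
  then show "(\<Sum>i<m. \<Sum>j<m. f i (w j) * f j (v (w i))) = 0" using two by simp
qed

end

section \<open>Orthogonality and hyperbolic complements\<close>

locale form_space = finite_dimensional_vector_space scale Basis
  for scale :: "'a::field \<Rightarrow> 'v::ab_group_add \<Rightarrow> 'v" (infixr \<open>*s\<close> 75) and Basis :: "'v set" +
  fixes b :: "'v \<Rightarrow> 'v \<Rightarrow> 'a"
  assumes two: "(2::'a) \<noteq> 0"
    and bilinear: "bilinear_form scale b"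
    and symmetric: "symmetric_form b"
    and nondeg: "nondegenerate b"
begin

sublocale ends: vector_space "end_scale scale"
  by unfold_locales (auto simp: end_scale_def scale_right_distrib scale_left_distrib)

lemma form_linear: "Vector_Spaces.linear scale (*) (b x)"
  using bilinear by (simp add: bilinear_form_def)

lemma form_commute: "b x y = b y x"
  using symmetric by (simp add: symmetric_form_def)

lemma form_simps [simp]:
  "b x (y + z) = b x y + b x z" "b (y + z) x = b y x + b z x"
  "b x (c *s y) = c * b x y" "b (c *s y) x = c * b y x"
proof -
  show 1: "b x (y + z) = b x y + b x z" "b x (c *s y) = c * b x y" for x y z c
    using form_linear[of x] by (auto simp: linear_functional_iff)
  show "b (y + z) x = b y x + b z x" "b (c *s y) x = c * b y x"
    using 1[of x] by (simp_all add: form_commute)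
qed

lemma form_zero [simp]: "b x 0 = 0" "b 0 x = 0"
  using form_simps(3)[of x 0 0] form_simps(4)[of 0 0 x] by simp_all

lemma form_minus [simp]: "b x (- y) = - b x y" "b (- y) x = - b y x"
  using form_simps(3)[of x "-1" y] form_simps(4)[of "-1" y x] by simp_all

lemma form_diff [simp]: "b x (y - z) = b x y - b x z" "b (y - z) x = b y x - b z x"
  using form_simps(1)[of x y "- z"] form_simps(2)[of y "- z" x] by simp_all

lemma half_add_half: "c / 2 + c / 2 = (c :: 'a)"
  using two by (metis add_divide_distrib mult_2 nonzero_mult_div_cancel_left)

lemma double_eq_zero: "c + c = (0::'a) \<longleftrightarrow> c = 0"
  using two by (metis mult_2 mult_eq_0_iff)

lemma b_symmetric_iff:
  "u \<in> b_symmetric scale b \<longleftrightarrow>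
    (\<forall>x y. u (x + y) = u x + u y) \<and> (\<forall>c x. u (c *s x) = c *s u x) \<and> (\<forall>x y. b x (u y) = b (u x) y)"
  by (auto simp: b_symmetric_def Vector_Spaces.linear_iff vector_space_axioms form_commute)

lemma b_symmetric_linear: "u \<in> b_symmetric scale b \<Longrightarrow> Vector_Spaces.linear scale scale u"
  by (simp add: b_symmetric_def)

lemma b_symmetricD:
  assumes "u \<in> b_symmetric scale b"
  shows "u (x + y) = u x + u y" "u (c *s x) = c *s u x" "u 0 = 0" "u (x - y) = u x - u y"
    "u (- x) = - u x" "b (u x) y = b x (u y)"
proof -
  show 1: "u (x + y) = u x + u y" "u (c *s x) = c *s u x" "b (u x) y = b x (u y)" for x y c
    using assms unfolding b_symmetric_iff by auto
  show z: "u 0 = 0" using 1(2)[of 0 0] by simp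
  show m: "u (- x) = - u x" for x using 1(2)[of "-1" x] by simp
  show "u (x - y) = u x - u y" using 1(1)[of x "- y"] m by simp
qed

lemma b_symmetric_funpow:
  assumes "u \<in> b_symmetric scale b"
  shows "u ^^ k \<in> b_symmetric scale b"
proof (induction k)
  case 0
  show ?case by (simp add: b_symmetric_iff)
next
  case (Suc k)
  then show ?case
    using assms unfolding b_symmetric_iff by (auto simp: funpow_swap1)
qed

lemma b_symmetric_subspace: "ends.subspace (b_symmetric scale b)"
  unfolding ends.subspace_def
  by (auto simp: b_symmetric_iff end_scale_def algebra_simps)

text \<open>For equal arguments, \<open>tens x x\<close> is twice the map
  \<open>t \<mapsto> b x t *s x\<close>.\<close>

definition tens :: "'v \<Rightarrow> 'v \<Rightarrow> 'v \<Rightarrow> 'v" where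
  "tens x y = (\<lambda>t. b y t *s x + b x t *s y)"

lemma tens_apply: "tens x y t = b y t *s x + b x t *s y"
  by (simp add: tens_def)

lemma tens_commute: "tens x y = tens y x"
  by (simp add: tens_def add.commute)

lemma tens_symmetric: "tens x y \<in> b_symmetric scale b"
  by (auto simp: b_symmetric_iff tens_def algebra_simps form_commute)

lemma tens_add: "tens x (y + z) = tens x y + tens x z" "tens (y + z) x = tens y x + tens z x"
  by (auto simp: tens_def algebra_simps fun_eq_iff)

lemma tens_diff: "tens x (y - z) = tens x y - tens x z" "tens (y - z) x = tens y x - tens z x"
  by (auto simp: tens_def algebra_simps fun_eq_iff)

lemma tens_scale: "tens x (c *s y) = end_scale scale c (tens x y)"
    "tens (c *s x) y = end_scale scale c (tens x y)"
  by (auto simp: tens_def algebra_simps fun_eq_iff end_scale_def)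

definition perp :: "'v set \<Rightarrow> 'v set" where
  "perp W = {y. \<forall>w\<in>W. b w y = 0}"

lemma subspace_perp: "subspace (perp W)"
  by (auto simp: subspace_def perp_def)

lemma perp_span [simp]: "perp (span W) = perp W"
proof
  show "perp (span W) \<subseteq> perp W" by (auto simp: perp_def span_base)
  show "perp W \<subseteq> perp (span W)"
  proof
    fix y assume y: "y \<in> perp W"
    have "b w y = 0" if "w \<in> span W" for w
      using that by (induction rule: span_induct_alt) (use y in \<open>auto simp: perp_def\<close>)
    then show "y \<in> perp (span W)" by (simp add: perp_def)
  qed
qed

section \<open>Orthogonal complements inside a nondegenerate subspace\<close>

lemma dim_inter_kernel:
  assumes A: "subspace A"
  shows "dim A \<le> dim (A \<inter> {x. b c x = 0}) + 1"
proof (cases "A \<subseteq> {x. b c x = 0}")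
  case True
  then have "A \<inter> {x. b c x = 0} = A" by blast
  then show ?thesis by simp
next
  case False
  then obtain a where a: "a \<in> A" "b c a \<noteq> 0" by auto
  have "A \<subseteq> span (insert a (A \<inter> {x. b c x = 0}))"
  proof
    fix x assume x: "x \<in> A"
    have "x - (b c x / b c a) *s a \<in> A \<inter> {x. b c x = 0}"
      using x a A by (auto intro: subspace_diff subspace_scale)
    from span_base[OF this] show "x \<in> span (insert a (A \<inter> {x. b c x = 0}))"
      unfolding span_breakdown_eq by (rule exI)
  qed
  then have "dim A \<le> dim (insert a (A \<inter> {x. b c x = 0}))"
    by (rule dim_mono)
  then show ?thesis by (simp add: dim_insert split: if_splits)
qed

lemma dim_inter_perp:
  assumes "finite C" "subspace A"
  shows "dim A \<le> dim (A \<inter> perp C) + card C"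
  using assms(1)
proof (induction C rule: finite_induct)
  case empty
  show ?case by (simp add: perp_def)
next
  case (insert c C)
  have "A \<inter> perp (insert c C) = (A \<inter> perp C) \<inter> {x. b c x = 0}"
    by (auto simp: perp_def)
  moreover have "dim (A \<inter> perp C) \<le> dim ((A \<inter> perp C) \<inter> {x. b c x = 0}) + 1"
    by (intro dim_inter_kernel subspace_inter assms(2) subspace_perp)
  ultimately show ?case using insert by simp
qed

definition nondegenerate_on :: "'v set \<Rightarrow> bool" where
  "nondegenerate_on E \<longleftrightarrow> (\<forall>x\<in>E. (\<forall>y\<in>E. b x y = 0) \<longrightarrow> x = 0)"

text \<open>One inequality counts the linear conditions imposed by a basis of \<open>W\<close>. For
  the other, a basis \<open>A\<close> of \<open>E \<inter> perp W\<close> is extended to a basis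
  \<open>D\<close> of \<open>E\<close>: a vector of \<open>W\<close> orthogonal to
  \<open>D - A\<close> is orthogonal to all of \<open>E\<close>, so \<open>card (D - A)\<close>
  bounds \<open>dim W\<close>.\<close>

lemma dim_perp:
  assumes E: "subspace E" "nondegenerate_on E" and W: "subspace W" "W \<subseteq> E"
  shows "dim W + dim (E \<inter> perp W) = dim E"
proof (rule antisym)
  obtain B where B: "B \<subseteq> W" "independent B" "W \<subseteq> span B" "card B = dim W"
    using basis_exists by blast
  have "span B = W" using B W by (meson span_subspace)
  then have "perp W = perp B" by (metis perp_span)
  then show "dim E \<le> dim W + dim (E \<inter> perp W)"
    using dim_inter_perp[OF finiteI_independent[OF B(2)] E(1)] B(4) by simp
  obtain A where A: "A \<subseteq> E \<inter> perp W" "independent A" "E \<inter> perp W \<subseteq> span A" "card A = dim (E \<inter> perp W)"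
    using basis_exists by blast
  obtain D where D: "A \<subseteq> D" "D \<subseteq> E" "independent D" "E \<subseteq> span D"
    using maximal_independent_subset_extend[of A E] A by blast
  have cD: "card D = dim E" using D by (simp add: basis_card_eq_dim)
  have fD: "finite D" by (rule finiteI_independent[OF D(3)])
  have "W \<inter> perp (D - A) \<subseteq> {0}"
  proof
    fix w assume w: "w \<in> W \<inter> perp (D - A)"
    have "b w d = 0" if "d \<in> D" for d
    proof (cases "d \<in> A")
      case True
      then show ?thesis using A w by (auto simp: perp_def)
    next
      case False
      then show ?thesis using that w form_commute[of w d] by (auto simp: perp_def)
    qed
    then have "w \<in> perp D" by (simp add: perp_def form_commute)
    then have "w \<in> perp (span D)" by simp
    then have "\<forall>y\<in>E. b w y = 0" using D(4) form_commute[of w] by (auto simp del: perp_span simp: perp_def)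
    then show "w \<in> {0}" using E(2) w W(2) by (auto simp: nondegenerate_on_def)
  qed
  then have "dim (W \<inter> perp (D - A)) = 0" by simp
  moreover have "dim W \<le> dim (W \<inter> perp (D - A)) + card (D - A)"
    using fD W(1) by (intro dim_inter_perp) auto
  moreover have "card (D - A) = card D - card A"
    using D(1) fD by (meson card_Diff_subset finite_subset)
  moreover have "card A \<le> card D"
    using D(1) fD by (rule card_mono[rotated])
  ultimately show "dim W + dim (E \<inter> perp W) \<le> dim E"
    using cD A(4) by linarith
qed

text \<open>By dimension, \<open>W\<close> equals its double orthogonal in \<open>E\<close>. This
  turns membership in \<open>W\<close> into a test against the vectors orthogonal to
  \<open>W\<close>.\<close>

lemma biorthogonal:
  assumes E: "subspace E" "nondegenerate_on E" and W: "subspace W" "W \<subseteq> E"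
    and y: "y \<in> E" "\<And>t. t \<in> E \<Longrightarrow> (\<And>w. w \<in> W \<Longrightarrow> b w t = 0) \<Longrightarrow> b t y = 0"
  shows "y \<in> W"
proof -
  let ?P = "E \<inter> perp W"
  have P: "subspace ?P" using E(1) subspace_perp by (rule subspace_inter)
  have "dim ?P + dim (E \<inter> perp ?P) = dim E"
    by (rule dim_perp[OF E P]) auto
  moreover have "dim W + dim ?P = dim E" by (rule dim_perp[OF E W])
  moreover have "W \<subseteq> E \<inter> perp ?P" using W by (auto simp: perp_def form_commute)
  ultimately have "W = E \<inter> perp ?P"
    using E(1) subspace_perp W(1) by (intro subspace_dim_equal) (auto intro: subspace_inter)
  moreover have "y \<in> E \<inter> perp ?P" using y by (auto simp: perp_def)
  ultimately show ?thesis by simp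
qed

section \<open>Splitting off a hyperbolic plane\<close>

text \<open>Scale a vector not orthogonal to \<open>x\<close> to some \<open>z\<close> with
  \<open>b x z = 1\<close>, then subtract half of \<open>b z z\<close> times \<open>x\<close> to
  make it singular.\<close>

lemma hyperbolic_partner:
  assumes E: "subspace E" "nondegenerate_on E" and x: "x \<in> E" "b x x = 0" "x \<noteq> 0"
  obtains x' where "x' \<in> E" "b x x' = 1" "b x' x' = 0"
proof -
  obtain y where y: "y \<in> E" "b x y \<noteq> 0"
    using E(2) x by (auto simp: nondegenerate_on_def)
  define z where "z = (1 / b x y) *s y"
  have z: "z \<in> E" "b x z = 1" using y E(1) by (auto simp: z_def intro: subspace_scale)
  define x' where "x' = z - (b z z / 2) *s x"
  have "x' \<in> E" using z x E(1) by (auto simp: x'_def intro: subspace_diff subspace_scale)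
  moreover have "b x x' = 1" using z x by (simp add: x'_def)
  moreover have "b x' x' = 0"
  proof -
    have "b x' x' = b z z - (b z z / 2 + b z z / 2)"
      using z x form_commute[of z x] by (simp add: x'_def algebra_simps)
    then show ?thesis by (simp only: half_add_half) simp
  qed
  ultimately show thesis by (rule that)
qed

text \<open>For a hyperbolic pair \<open>x\<close>, \<open>x'\<close> this is the orthogonal
  projection onto \<open>perp {x, x'}\<close>, which serves as a model of
  \<open>x\<^sup>\<bottom>/x\<close>.\<close>

definition proj :: "'v \<Rightarrow> 'v \<Rightarrow> 'v \<Rightarrow> 'v" where
  "proj x x' t = t - b x' t *s x - b x t *s x'"

lemma proj_linear: "proj x x' (s + t) = proj x x' s + proj x x' t" "proj x x' (c *s t) = c *s proj x x' t"
    "proj x x' (s - t) = proj x x' s - proj x x' t"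
  by (simp_all add: proj_def algebra_simps)

text \<open>If \<open>u x = 0\<close>, this is the map induced by \<open>u\<close> on
  \<open>x\<^sup>\<bottom>/x\<close>, transported to \<open>perp {x, x'}\<close> and extended by
  zero.\<close>

definition compress :: "'v \<Rightarrow> 'v \<Rightarrow> ('v \<Rightarrow> 'v) \<Rightarrow> 'v \<Rightarrow> 'v" where
  "compress x x' u = (\<lambda>t. proj x x' (u (proj x x' t)))"

context
  fixes E x x'
  assumes E: "subspace E" "nondegenerate_on E"
    and x: "x \<in> E" "b x x = 0" and x': "x' \<in> E" "b x x' = 1" "b x' x' = 0"
begin

lemma proj_simps: "b x (proj x x' t) = 0" "b x' (proj x x' t) = 0" "proj x x' (proj x x' t) = proj x x' t"
  "proj x x' x = 0" "proj x x' x' = 0"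
proof -
  show 1: "b x (proj x x' t) = 0" "b x' (proj x x' t) = 0"
    using x x' form_commute[of x' x] by (auto simp: proj_def)
  show "proj x x' (proj x x' t) = proj x x' t"
    using 1 by (simp add: proj_def[of x x' "proj x x' t"])
  show "proj x x' x = 0" "proj x x' x' = 0"
    using x x' form_commute[of x' x] by (auto simp: proj_def)
qed

lemma form_proj: "b (proj x x' s) t = b s (proj x x' t)"
  by (simp add: proj_def algebra_simps form_commute)

lemma proj_in: "t \<in> E \<Longrightarrow> proj x x' t \<in> E \<inter> perp {x, x'}"
  using E x x' proj_simps by (auto simp: perp_def proj_def intro!: subspace_diff subspace_scale)

lemma proj_id: "t \<in> E \<inter> perp {x, x'} \<Longrightarrow> proj x x' t = t"
  by (auto simp: perp_def proj_def)

text \<open>Nondegeneracy: for \<open>e\<close> in the complement,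
  \<open>b e t = b e (proj x x' t)\<close> because the projection is self-adjoint, so testing
  against the complement is testing against \<open>E\<close>.\<close>

lemma hyperbolic_complement:
  shows "subspace (E \<inter> perp {x, x'})" "nondegenerate_on (E \<inter> perp {x, x'})"
    and "dim (E \<inter> perp {x, x'}) + 2 = dim E"
proof -
  show "subspace (E \<inter> perp {x, x'})" using E(1) subspace_perp by (rule subspace_inter)
  show "nondegenerate_on (E \<inter> perp {x, x'})"
    unfolding nondegenerate_on_def
  proof (intro ballI impI)
    fix e assume e: "e \<in> E \<inter> perp {x, x'}" "\<forall>y\<in>E \<inter> perp {x, x'}. b e y = 0"
    have "b e t = 0" if "t \<in> E" for t
    proof -
      have "b e t = b e (proj x x' t)" using e(1) proj_id form_proj by metis
      then show ?thesis using e(2) proj_in[OF that] by auto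
    qed
    then show "e = 0" using E(2) e(1) by (auto simp: nondegenerate_on_def)
  qed
  have x0: "x \<noteq> 0" using x'(2) by auto
  have "x' \<notin> span {x}"
    using x x' by (auto simp: span_singleton)
  then have "dim (span {x', x}) = 2"
    using x0 by (simp only: dim_span) (simp add: dim_insert)
  moreover have "span {x', x} \<subseteq> E" using x x' E(1) by (intro span_minimal) auto
  ultimately show "dim (E \<inter> perp {x, x'}) + 2 = dim E"
    using dim_perp[OF E, of "span {x', x}"] by (simp add: insert_commute)
qed

lemma compress_symmetric:
  assumes u: "u \<in> b_symmetric scale b" "range u \<subseteq> E"
  shows "compress x x' u \<in> b_symmetric scale b" "range (compress x x' u) \<subseteq> E \<inter> perp {x, x'}"
proof -
  show "compress x x' u \<in> b_symmetric scale b"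
    unfolding b_symmetric_iff compress_def
    by (auto simp: proj_linear b_symmetricD[OF u(1)] form_proj)
  show "range (compress x x' u) \<subseteq> E \<inter> perp {x, x'}"
    unfolding compress_def using proj_in u(2) by blast
qed

text \<open>On vectors orthogonal to \<open>x\<close>, \<open>proj x x'\<close> intertwines
  \<open>u\<close> with its compression, because \<open>u\<close> kills \<open>x\<close> and has
  range orthogonal to \<open>x\<close>.\<close>

lemma compress_nilpotent:
  assumes u: "u \<in> b_symmetric scale b" "u x = 0" "nilpotent_end u"
  shows "nilpotent_end (compress x x' u)"
proof -
  obtain K where K: "(u ^^ K) = (\<lambda>_. 0)" using u(3) by (auto simp: nilpotent_end_def)
  have *: "b x (u s) = 0" for s
    using b_symmetricD(6)[OF u(1), of x s] u(2) by simp
  have step: "proj x x' (u (proj x x' s)) = proj x x' (u s)" if "b x s = 0" for s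
    using that u(2) by (simp add: proj_def[of x x' s] b_symmetricD[OF u(1)])
  have "(compress x x' u ^^ k) (proj x x' s) = proj x x' ((u ^^ k) s) \<and> b x ((u ^^ k) s) = 0"
    if "b x s = 0" for k s
    by (induction k) (auto simp: that * compress_def proj_simps step)
  \<comment> \<open>The extra application first brings \<open>t\<close> to the form
    \<open>proj x x' s\<close> with \<open>s\<close> orthogonal to \<open>x\<close>.\<close>
  then have "(compress x x' u ^^ Suc K) t = 0" for t
    using * K by (simp add: funpow_Suc_right compress_def[of x x' u] del: funpow.simps)
      (simp add: proj_def)
  then show ?thesis unfolding nilpotent_end_def by blast
qed

text \<open>Identifies what compression forgets. Both sides are compared on \<open>x\<close>, on
  \<open>x'\<close> and on \<open>perp {x, x'}\<close>, which together span the space.\<close>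

lemma compress_kernel:
  assumes u: "u \<in> b_symmetric scale b" "range u \<subseteq> E" "u x = 0" and c: "compress x x' u = (\<lambda>_. 0)"
  obtains y where "y \<in> E" "b x y = 0" "u = tens x y"
proof -
  \<comment> \<open>Evaluating \<open>u = tens x y\<close> at \<open>x'\<close> forces
    \<open>y = u x' - b y x' *s x\<close>; pairing this with \<open>x'\<close> forces
    \<open>b y x'\<close> to be half of \<open>b x' (u x')\<close>.\<close>
  define y where "y = u x' - (b x' (u x') / 2) *s x"
  note uD = b_symmetricD[OF u(1)]
  have yE: "y \<in> E" using u(2) x E(1) by (auto simp: y_def intro!: subspace_diff subspace_scale)
  have xy: "b x y = 0" using uD(6)[of x x'] u(3) x by (simp add: y_def)
  have x'y: "b y x' = b x' (u x') / 2"
  proof -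
    have "b y x' = b x' (u x') - b x' (u x') / 2"
      using x' form_commute[of "u x'" x'] by (simp add: y_def)
    then show ?thesis by (metis half_add_half add_diff_cancel_right')
  qed
  have 1: "u x' = tens x y x'"
    using x'(2) two form_commute[of "u x'" x'] by (simp add: tens_apply x'y y_def)
  have 2: "u x = tens x y x"
    using u(3) x xy by (simp add: tens_apply form_commute)
  have 3: "u t = tens x y t" if t: "b x t = 0" "b x' t = 0" for t
  proof -
    have pt: "proj x x' t = t" using t by (simp add: proj_def)
    have "proj x x' (u t) = 0" using fun_cong[OF c, of t] by (simp add: compress_def pt)
    moreover have "b x (u t) = 0" using uD(6)[of x t] u(3) by simp
    ultimately have "u t = b x' (u t) *s x" by (simp add: proj_def)
    moreover have "b x' (u t) = b y t" using uD(6)[of x' t] t by (simp add: y_def)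
    ultimately show ?thesis using t by (simp add: tens_apply)
  qed
  have "u t = tens x y t" for t
  proof -
    have t: "t = proj x x' t + (b x' t *s x + b x t *s x')" by (simp add: proj_def)
    have "u t = u (proj x x' t) + (b x' t *s u x + b x t *s u x')"
      by (subst t) (simp add: uD)
    also have "\<dots> = tens x y (proj x x' t) + (b x' t *s tens x y x + b x t *s tens x y x')"
      using 1 2 3 proj_simps by simp
    also have "\<dots> = tens x y t"
      by (subst (4) t) (simp add: b_symmetricD[OF tens_symmetric])
    finally show ?thesis .
  qed
  then have "u = tens x y" by (rule ext)
  with yE xy show thesis by (rule that)
qed

end

end

section \<open>The dimension bound\<close>

text \<open>Rank-nullity, phrased with finite spanning sets because \<open>ends\<close> is treated
  as a bare \<open>vector_space\<close> without a chosen finite basis.\<close>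

lemma span_bound_image_kernel:
  assumes lin: "Vector_Spaces.linear s1 s2 \<phi>" and A: "module.subspace s1 A"
    and B2: "finite B2" "\<phi> ` A \<subseteq> module.span s2 B2"
    and B1: "finite B1" "{x\<in>A. \<phi> x = 0} \<subseteq> module.span s1 B1"
  shows "\<exists>B. finite B \<and> card B \<le> card B2 + card B1 \<and> A \<subseteq> module.span s1 B"
proof -
  interpret Vector_Spaces.linear s1 s2 \<phi> by fact
  obtain C where C: "C \<subseteq> \<phi> ` A" "vs2.independent C" "\<phi> ` A \<subseteq> vs2.span C"
    by (rule vs2.basis_exists[of "\<phi> ` A"])
  have "C \<subseteq> vs2.span B2" using C(1) B2(2) by blast
  then have fC: "finite C" "card C \<le> card B2"
    using vs2.independent_span_bound[OF B2(1) C(2)] by auto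
  have "\<forall>c\<in>C. \<exists>a. a \<in> A \<and> \<phi> a = c" using C(1) by blast
  then obtain g where g: "\<And>c. c \<in> C \<Longrightarrow> g c \<in> A \<and> \<phi> (g c) = c" by metis
  have gA: "vs1.span (g ` C) \<subseteq> A" using g A by (intro vs1.span_minimal) auto
  have "\<phi> ` g ` C = C" using g by (force simp: image_image)
  then have im: "vs2.span C = \<phi> ` vs1.span (g ` C)" by (metis span_image)
  have "A \<subseteq> vs1.span (g ` C \<union> B1)"
  proof
    fix u assume u: "u \<in> A"
    then have "\<phi> u \<in> \<phi> ` vs1.span (g ` C)" using C(3) im by auto
    then obtain t where t: "t \<in> vs1.span (g ` C)" "\<phi> t = \<phi> u" by auto
    have "u - t \<in> A" using u t(1) gA A by (auto intro: vs1.subspace_diff)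
    then have "u - t \<in> vs1.span B1" using t(2) B1(2) by (auto simp: diff)
    then have "u - t \<in> vs1.span (g ` C \<union> B1)" "t \<in> vs1.span (g ` C \<union> B1)"
      using t(1) vs1.span_mono[of B1 "g ` C \<union> B1"] vs1.span_mono[of "g ` C" "g ` C \<union> B1"] by auto
    then have "(u - t) + t \<in> vs1.span (g ` C \<union> B1)" by (rule vs1.span_add)
    then show "u \<in> vs1.span (g ` C \<union> B1)" by simp
  qed
  moreover have "card (g ` C \<union> B1) \<le> card B2 + card B1"
    using card_Un_le[of "g ` C" B1] card_image_le[OF fC(1), of g] fC(2) by linarith
  ultimately show ?thesis using fC(1) B1(1) by (intro exI[of _ "g ` C \<union> B1"] conjI) simp_all
qed

lemma (in vector_space) span_pair: "t \<in> span {x, y} \<longleftrightarrow> (\<exists>\<alpha> \<beta>. t = \<alpha> *s x + \<beta> *s y)"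
proof -
  have "t \<in> span {x, y} \<longleftrightarrow> (\<exists>\<alpha> \<beta>. t - \<alpha> *s x = \<beta> *s y)"
    by (simp add: span_breakdown_eq[of _ x "{y}"] span_singleton image_iff)
  then show ?thesis by (simp add: diff_eq_eq add.commute)
qed

lemma (in vector_space) nilpotent_eigenvalue:
  assumes "Vector_Spaces.linear scale scale u" "nilpotent_end u" "u x = c *s x"
  shows "u x = 0"
proof (rule ccontr)
  assume "u x \<noteq> 0"
  then have c: "c \<noteq> 0" "x \<noteq> 0" using assms(3) by auto
  interpret u: Vector_Spaces.linear scale scale u by fact
  have "(u ^^ k) x = (c ^ k) *s x" for k
    by (induction k) (auto simp: assms(3) u.scale mult.commute)
  moreover obtain K where "(u ^^ K) = (\<lambda>_. 0)" using assms(2) by (auto simp: nilpotent_end_def)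
  ultimately have "(c ^ K) *s x = 0" by metis
  then show False using c by simp
qed

context form_space
begin

text \<open>Only an upper bound for the Witt index of \<open>E\<close> is recorded, a property that
  descends to hyperbolic complements. The condition \<open>2 * r \<le> dim E\<close> keeps the
  subtraction in \<open>dim E - r\<close> exact.\<close>

definition singular_bound :: "'v set \<Rightarrow> nat \<Rightarrow> bool" where
  "singular_bound E r \<longleftrightarrow> 2 * r \<le> dim E \<and>
    (\<forall>X. subspace X \<and> X \<subseteq> E \<and> totally_singular b X \<longrightarrow> dim X \<le> r)"

lemma totally_singular_span:
  assumes "totally_singular b X"
  shows "totally_singular b (span X)"
proof -
  have "X \<subseteq> perp X" using assms by (auto simp: totally_singular_def perp_def)
  then have "span X \<subseteq> perp (span X)" unfolding perp_span
    using subspace_perp by (rule span_minimal)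
  then show ?thesis by (auto simp del: perp_span simp: totally_singular_def perp_def)
qed

text \<open>Adjoining \<open>x\<close> to a totally singular subspace of the complement keeps it
  totally singular and raises its dimension by one, since \<open>x'\<close> pairs to 1 with
  \<open>x\<close> and to 0 with the subspace.\<close>

lemma singular_bound_hyperbolic:
  assumes E: "subspace E" "nondegenerate_on E" and r: "singular_bound E r"
    and x: "x \<in> E" "b x x = 0" and x': "x' \<in> E" "b x x' = 1" "b x' x' = 0"
  shows "0 < r" "singular_bound (E \<inter> perp {x, x'}) (r - 1)"
proof -
  have x0: "x \<noteq> 0" using x'(2) by auto
  have ext: "dim X + 1 \<le> r" if X: "subspace X" "X \<subseteq> E \<inter> perp {x, x'}" "totally_singular b X" for X
  proof -
    have "totally_singular b (insert x X)"
      using X(2,3) x(2) by (auto simp: totally_singular_def perp_def form_commute)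
    then have "totally_singular b (span (insert x X))" by (rule totally_singular_span)
    moreover have "span (insert x X) \<subseteq> E" using X(2) x(1) E(1) by (intro span_minimal) auto
    ultimately have "dim (span (insert x X)) \<le> r"
      using r by (auto simp: singular_bound_def)
    moreover have "x \<notin> span X"
    proof -
      have "span X = X" using X(1) by simp
      moreover have "b x' x \<noteq> 0" using x'(2) by (simp add: form_commute)
      moreover have "\<forall>t\<in>X. b x' t = 0" using X(2) by (auto simp: perp_def)
      ultimately show ?thesis by metis
    qed
    then have "dim (insert x X) = dim X + 1" by (simp add: dim_insert)
    ultimately show ?thesis by simp
  qed
  have "dim {0} + 1 \<le> r"
    by (rule ext) (auto simp: perp_def totally_singular_def subspace_0[OF E(1)])
  then show "0 < r" by simp
  show "singular_bound (E \<inter> perp {x, x'}) (r - 1)"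
    unfolding singular_bound_def
  proof (intro conjI allI impI)
    show "2 * (r - 1) \<le> dim (E \<inter> perp {x, x'})"
      using hyperbolic_complement(3)[OF E x x'] r by (auto simp: singular_bound_def)
    show "dim X \<le> r - 1" if "subspace X \<and> X \<subseteq> E \<inter> perp {x, x'} \<and> totally_singular b X" for X
      using ext[of X] that by auto
  qed
qed

lemma compress_linear: "Vector_Spaces.linear (end_scale scale) (end_scale scale) (compress x x')"
  unfolding Vector_Spaces.linear_iff
  by (auto simp: ends.vector_space_axioms compress_def end_scale_def fun_eq_iff proj_linear)

lemma apply_linear: "Vector_Spaces.linear (end_scale scale) scale (\<lambda>u. u x)"
  unfolding Vector_Spaces.linear_iff
  by (auto simp: ends.vector_space_axioms vector_space_axioms end_scale_def)

lemma tens_linear: "Vector_Spaces.linear scale (end_scale scale) (tens x)"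
  unfolding Vector_Spaces.linear_iff
  by (auto simp: ends.vector_space_axioms vector_space_axioms tens_add tens_scale)

text \<open>Take \<open>x\<close> in the image of the last nonzero power of \<open>u\<close>. By
  symmetry \<open>b x x\<close> involves a still higher power, which vanishes.\<close>

lemma nilpotent_symmetric_singular_kernel:
  assumes u: "u \<in> b_symmetric scale b" "nilpotent_end u" "u \<noteq> (\<lambda>_. 0)"
  obtains x where "x \<in> range u" "x \<noteq> 0" "b x x = 0" "u x = 0"
proof -
  have ex: "\<exists>K. (u ^^ K) = (\<lambda>_. 0)" using u(2) by (simp add: nilpotent_end_def)
  define K where "K = (LEAST K. (u ^^ K) = (\<lambda>_. 0))"
  have K: "(u ^^ K) = (\<lambda>_. 0)" unfolding K_def using ex by (rule LeastI_ex)
  have "K \<noteq> 1" using K u(3) by auto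
  have "K \<noteq> 0"
  proof
    assume "K = 0"
    then have "t = 0" for t :: 'v using fun_cong[OF K, of t] by simp
    then show False using u(3) by (metis ext)
  qed
  then obtain k where k: "K = Suc (Suc k)" using \<open>K \<noteq> 1\<close>
    by (metis One_nat_def not0_implies_Suc)
  have "(u ^^ Suc k) \<noteq> (\<lambda>_. 0)"
  proof
    assume "(u ^^ Suc k) = (\<lambda>_. 0)"
    then have "K \<le> Suc k" unfolding K_def by (rule Least_le)
    then show False using k by simp
  qed
  then obtain t where t: "(u ^^ Suc k) t \<noteq> 0" by (auto simp: fun_eq_iff)
  define x where "x = (u ^^ Suc k) t"
  have "u x = 0" using fun_cong[OF K, of t] by (simp add: k x_def)
  moreover have "b x x = 0"
  proof -
    have "b x x = b t ((u ^^ Suc k) x)"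
      unfolding x_def by (rule b_symmetricD(6)[OF b_symmetric_funpow[OF u(1)]])
    also have "(u ^^ Suc k) x = (u ^^ k) (u x)" by (simp add: funpow_swap1)
    also have "\<dots> = 0" using \<open>u x = 0\<close> b_symmetricD(3)[OF b_symmetric_funpow[OF u(1)]] by simp
    finally show ?thesis by simp
  qed
  moreover have "x \<in> range u" "x \<noteq> 0" using t by (auto simp: x_def)
  ultimately show thesis using that by blast
qed

lemma singular_bound_zero_nilpotent:
  assumes E: "subspace E" "nondegenerate_on E" "singular_bound E 0"
    and u: "u \<in> b_symmetric scale b" "range u \<subseteq> E" "nilpotent_end u"
  shows "u = (\<lambda>_. 0)"
proof (rule ccontr)
  assume "u \<noteq> (\<lambda>_. 0)"
  then obtain x where x: "x \<in> range u" "x \<noteq> 0" "b x x = 0" "u x = 0"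
    using nilpotent_symmetric_singular_kernel[OF u(1,3)] by blast
  have xE: "x \<in> E" using x(1) u(2) by auto
  then obtain x' where x': "x' \<in> E" "b x x' = 1" "b x' x' = 0"
    using hyperbolic_partner[OF E(1,2)] x by blast
  show False using singular_bound_hyperbolic(1)[OF E xE x(3) x'] by simp
qed

end

section \<open>Linear spaces of nilpotent symmetric endomorphisms\<close>

text \<open>Endomorphisms of \<open>E\<close> are modelled as symmetric maps of the whole space with
  values in \<open>E\<close>; symmetry makes them vanish on the orthogonal complement of
  \<open>E\<close>.\<close>

locale nil_space = form_space +
  fixes E :: "'b set" and VV :: "('b \<Rightarrow> 'b) set"
  assumes E: "subspace E" "nondegenerate_on E"
    and VV: "ends.subspace VV"
    and VV_symmetric: "u \<in> VV \<Longrightarrow> u \<in> b_symmetric scale b"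
    and VV_range: "u \<in> VV \<Longrightarrow> u t \<in> E"
    and VV_nilpotent: "u \<in> VV \<Longrightarrow> nilpotent_end u"
begin

lemmas VV_D = b_symmetricD[OF VV_symmetric]
lemmas VV_add = ends.subspace_add[OF VV]
  and VV_diff = ends.subspace_diff[OF VV]
  and VV_scale = ends.subspace_scale[OF VV]
  and VV_zero = ends.subspace_0[OF VV]

lemma VV_linear: "u \<in> VV \<Longrightarrow> Vector_Spaces.linear scale scale u"
  using VV_symmetric b_symmetric_linear by blast

lemma VV_funpow_symmetric: "v \<in> VV \<Longrightarrow> b ((v ^^ k) x) y = b x ((v ^^ k) y)"
  by (rule b_symmetricD(6)[OF b_symmetric_funpow[OF VV_symmetric]])

lemma VV_eigenvector:
  assumes "u \<in> VV" "u x = c *s x"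
  shows "u x = 0"
  using nilpotent_eigenvalue[OF VV_linear VV_nilpotent] assms by blast

text \<open>\<open>rank_two_update\<close> with \<open>f = b y\<close> and \<open>g = b x\<close>.
  By symmetry the two diagonal moment polynomials coincide, so trace zero makes both vanish. The
  determinant identity then says that the product of the off-diagonal ones is zero.\<close>

lemma tens_moments:
  assumes xy: "tens x y \<in> VV" and v: "v \<in> VV"
  shows "b x ((v ^^ k) y) = 0"
    and "(\<forall>k. b x ((v ^^ k) x) = 0) \<or> (\<forall>k. b y ((v ^^ k) y) = 0)"
proof -
  have v': "v + tens x y \<in> VV" "v - tens x y \<in> VV" using assms VV_add VV_diff by auto
  note upd = rank_two_update[where f = "b y" and g = "b x" and C = UNIV and x = x and y = y, OF VV_linear[OF v'(1)] VV_linear[OF v'(2)] VV_nilpotent[OF v]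
      VV_nilpotent[OF v'(1)] VV_nilpotent[OF v'(2)] two form_linear form_linear]
  have 1: "moment_poly (b y) v x + moment_poly (b x) v y = 0"
    by (rule upd(1)) (auto simp: tens_apply)
  have 2: "moment_poly (b y) v x * moment_poly (b x) v y = moment_poly (b y) v y * moment_poly (b x) v x"
    by (rule upd(2)) (auto simp: tens_apply)
  have c: "coeff (moment_poly (b s) v t) k = b s ((v ^^ k) t)" for s t k
    by (simp add: VV_nilpotent[OF v] form_linear)
  have z: "b x ((v ^^ k) y) = 0" for k
  proof -
    have "b y ((v ^^ k) x) + b x ((v ^^ k) y) = 0"
      using arg_cong[OF 1, of "\<lambda>p. coeff p k"] by (simp add: c)
    moreover have "b y ((v ^^ k) x) = b x ((v ^^ k) y)"
      using VV_funpow_symmetric[OF v] form_commute by metis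
    ultimately show ?thesis using two by simp
  qed
  show "b x ((v ^^ k) y) = 0" by (rule z)
  have "moment_poly (b x) v y = 0" by (rule poly_eqI) (simp add: c z)
  then have "moment_poly (b y) v y = 0 \<or> moment_poly (b x) v x = 0" using 2 by simp
  then show "(\<forall>k. b x ((v ^^ k) x) = 0) \<or> (\<forall>k. b y ((v ^^ k) y) = 0)"
    by (metis c coeff_0)
qed

lemma tens_orthogonal: "tens x y \<in> VV \<Longrightarrow> v \<in> VV \<Longrightarrow> b y (v x) = 0"
  using tens_moments(1)[of x y v 1] VV_D(6)[of v x y] form_commute by simp

definition orbit :: "'b \<Rightarrow> 'b set" where
  "orbit x = (\<lambda>u. u x) ` VV"

definition partners :: "'b \<Rightarrow> 'b set" where
  "partners x = {y \<in> E. b x y = 0 \<and> tens x y \<in> VV}"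

lemma subspace_orbit: "subspace (orbit x)"
proof -
  interpret l: Vector_Spaces.linear "end_scale scale" scale "\<lambda>u. u x" by (rule apply_linear)
  show ?thesis unfolding orbit_def by (rule l.subspace_image[OF VV])
qed

lemma orbit_subset: "orbit x \<subseteq> E"
  using VV_range by (auto simp: orbit_def)

lemma not_in_orbit: "x \<noteq> 0 \<Longrightarrow> x \<notin> orbit x"
  using VV_eigenvector[of _ x 1] by (fastforce simp: orbit_def)

lemma subspace_partners: "subspace (partners x)"
proof -
  interpret l: Vector_Spaces.linear scale "end_scale scale" "tens x" by (rule tens_linear)
  have "partners x = E \<inter> perp {x} \<inter> tens x -` VV" by (auto simp: partners_def perp_def)
  then show ?thesis
    by (simp add: subspace_inter E subspace_perp l.subspace_vimage[OF VV])
qed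

lemma dim_insert_orbit: "x \<noteq> 0 \<Longrightarrow> dim (insert x (orbit x)) = dim (orbit x) + 1"
  using not_in_orbit[of x] subspace_orbit[of x] by (simp add: dim_insert span_eq_iff[THEN iffD2])

lemma partners_subset:
  "partners x \<subseteq> E \<inter> perp (insert x (orbit x))"
  using tens_orthogonal form_commute by (fastforce simp: partners_def perp_def orbit_def)

lemma dim_insert_orbit_perp:
  assumes x: "x \<in> E" "x \<noteq> 0"
  shows "dim (orbit x) + 1 + dim (E \<inter> perp (insert x (orbit x))) = dim E"
proof -
  have "span (insert x (orbit x)) \<subseteq> E" using x(1) orbit_subset E(1) by (intro span_minimal) auto
  then show ?thesis
    using dim_perp[OF E, of "span (insert x (orbit x))"] dim_insert_orbit[OF x(2)] by simp
qed

lemma dim_orbit_partners: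
  assumes x: "x \<in> E" "x \<noteq> 0"
  shows "dim (orbit x) + dim (partners x) + 1 \<le> dim E"
  using dim_insert_orbit_perp[OF x] dim_subset[OF partners_subset[of x]] by linarith

lemma subspace_annihilator: "ends.subspace {u\<in>VV. u x = 0}"
proof -
  have "{u\<in>VV. u x = 0} = VV \<inter> {u. u x = 0}" by blast
  moreover have "ends.subspace {u. u x = 0}"
    by (auto simp: ends.subspace_def end_scale_def)
  ultimately show ?thesis using ends.subspace_inter[OF VV] by simp
qed

context
  fixes x x'
  assumes x: "x \<in> E" "b x x = 0" and x': "x' \<in> E" "b x x' = 1" "b x' x' = 0"
begin

lemma compress_nil_space:
  "nil_space scale Basis b (E \<inter> perp {x, x'}) (compress x x' ` {u\<in>VV. u x = 0})"
proof unfold_locales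
  interpret l: Vector_Spaces.linear "end_scale scale" "end_scale scale" "compress x x'"
    by (rule compress_linear)
  show "subspace (E \<inter> perp {x, x'})" "nondegenerate_on (E \<inter> perp {x, x'})"
    using hyperbolic_complement[OF E x x'] by auto
  show "ends.subspace (compress x x' ` {u\<in>VV. u x = 0})"
    by (rule l.subspace_image[OF subspace_annihilator])
  fix c assume "c \<in> compress x x' ` {u\<in>VV. u x = 0}"
  then obtain u where u: "u \<in> VV" "u x = 0" "c = compress x x' u" by auto
  have r: "range u \<subseteq> E" using VV_range[OF u(1)] by auto
  show "c \<in> b_symmetric scale b" "c t \<in> E \<inter> perp {x, x'}" for t
    using compress_symmetric[OF E x x' VV_symmetric[OF u(1)] r] u(3) by auto
  show "nilpotent_end c"
    using compress_nilpotent[OF E x x' VV_symmetric[OF u(1)] u(2) VV_nilpotent[OF u(1)]] u(3) by simp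
qed

text \<open>Rank-nullity twice: evaluation at \<open>x\<close> has image \<open>orbit x\<close> and
  kernel the annihilator of \<open>x\<close>; on the annihilator, the kernel of compression consists
  of the \<open>tens x y\<close> with \<open>y\<close> in \<open>partners x\<close>.\<close>

lemma span_bound_compress:
  assumes B': "finite B'" "compress x x' ` {u\<in>VV. u x = 0} \<subseteq> ends.span B'"
  shows "\<exists>B. finite B \<and> card B \<le> dim (orbit x) + (card B' + dim (partners x)) \<and> VV \<subseteq> ends.span B"
proof -
  interpret l: Vector_Spaces.linear scale "end_scale scale" "tens x" by (rule tens_linear)
  obtain BL where BL: "BL \<subseteq> partners x" "independent BL" "partners x \<subseteq> span BL" "card BL = dim (partners x)"
    using basis_exists by blast
  have fBL: "finite BL" by (rule finiteI_independent[OF BL(2)])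
  have "{u \<in> {u\<in>VV. u x = 0}. compress x x' u = 0} \<subseteq> ends.span (tens x ` BL)"
  proof
    fix u assume "u \<in> {u \<in> {u\<in>VV. u x = 0}. compress x x' u = 0}"
    then have u: "u \<in> VV" "u x = 0" "compress x x' u = (\<lambda>_. 0)" by (auto simp: zero_fun_def)
    have r: "range u \<subseteq> E" using VV_range[OF u(1)] by auto
    obtain y where y: "y \<in> E" "b x y = 0" "u = tens x y"
      using compress_kernel[OF E x x' VV_symmetric[OF u(1)] r u(2,3)] by blast
    then have "y \<in> partners x" using u(1) by (simp add: partners_def)
    then show "u \<in> ends.span (tens x ` BL)"
      using l.spans_image[OF BL(3)] y(3) by auto
  qed
  then obtain B1 where B1: "finite B1" "card B1 \<le> card B' + card (tens x ` BL)" "{u\<in>VV. u x = 0} \<subseteq> ends.span B1"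
    using span_bound_image_kernel[OF compress_linear subspace_annihilator B' finite_imageI[OF fBL]] by blast
  have B1': "card B1 \<le> card B' + dim (partners x)"
    using B1(2) card_image_le[OF fBL, of "tens x"] BL(4) by linarith
  obtain BO where BO: "BO \<subseteq> orbit x" "independent BO" "orbit x \<subseteq> span BO" "card BO = dim (orbit x)"
    using basis_exists by blast
  obtain B where "finite B" "card B \<le> card BO + card B1" "VV \<subseteq> ends.span B"
    using span_bound_image_kernel[OF apply_linear VV finiteI_independent[OF BO(2)] _ B1(1,3)] BO(3)
    unfolding orbit_def by blast
  then show ?thesis using B1' BO(4) by (intro exI[of _ B]) auto
qed

end

end

context form_space
begin

lemma nil_space_span_bound:
  assumes "nil_space scale Basis b E VV" "singular_bound E r"
  shows "\<exists>B. finite B \<and> card B \<le> r * (dim E - r) \<and> VV \<subseteq> ends.span B"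
  using assms
proof (induction r arbitrary: E VV)
  case (0 E VV)
  interpret nil_space scale Basis b E VV by fact
  have "u = 0" if "u \<in> VV" for u
    using singular_bound_zero_nilpotent[OF E 0(2) VV_symmetric[OF that] _ VV_nilpotent[OF that]] VV_range[OF that]
    by (auto simp: zero_fun_def)
  then have "VV \<subseteq> {0}" by blast
  then show ?case by (intro exI[of _ "{}"]) simp
next
  case (Suc r E VV)
  interpret nil_space scale Basis b E VV by fact
  show ?case
  proof (cases "\<exists>x\<in>E. x \<noteq> 0 \<and> b x x = 0")
    case True
    then obtain x where x: "x \<in> E" "x \<noteq> 0" "b x x = 0" by blast
    then obtain x' where x': "x' \<in> E" "b x x' = 1" "b x' x' = 0"
      using hyperbolic_partner[OF E] by blast
    obtain B' where B': "finite B'" "card B' \<le> r * (dim (E \<inter> perp {x, x'}) - r)"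
      "compress x x' ` {u\<in>VV. u x = 0} \<subseteq> ends.span B'"
      using Suc.IH[OF compress_nil_space[OF x(1,3) x']]
        singular_bound_hyperbolic(2)[OF E Suc.prems(2) x(1,3) x'] by auto
    obtain B where B: "finite B" "card B \<le> dim (orbit x) + (card B' + dim (partners x))" "VV \<subseteq> ends.span B"
      using span_bound_compress[OF x(1,3) x' B'(1,3)] by blast
    \<comment> \<open>In terms of \<open>d\<close> the count reads
      \<open>r (r + d) + (2 r + d + 1) = (r + 1) (r + d + 1)\<close>, free of subtraction.\<close>
    obtain d where d: "dim (E \<inter> perp {x, x'}) = 2 * r + d"
      using singular_bound_hyperbolic(2)[OF E Suc.prems(2) x(1,3) x']
      by (auto simp: singular_bound_def le_iff_add)
    then have dE: "dim E = 2 * r + d + 2" using hyperbolic_complement(3)[OF E x(1,3) x'] by simp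
    have "card B \<le> Suc r * (dim E - Suc r)"
      using B(2) B'(2) dim_orbit_partners[OF x(1,2)] unfolding d dE by (simp add: algebra_simps)
    then show ?thesis using B by blast
  next
    case False
    have "VV \<subseteq> {0}"
    proof
      fix u assume u: "u \<in> VV"
      show "u \<in> {0}"
      proof (rule ccontr)
        assume "u \<notin> {0}"
        then have "u \<noteq> (\<lambda>_. 0)" by (auto simp: zero_fun_def)
        then obtain x where x: "x \<in> range u" "x \<noteq> 0" "b x x = 0" "u x = 0"
          using nilpotent_symmetric_singular_kernel[OF VV_symmetric[OF u] VV_nilpotent[OF u]] by blast
        have xE: "x \<in> E" using x(1) VV_range[OF u] by auto
        then show False using False x by blast
      qed
    qed
    then show ?thesis by (intro exI[of _ "{}"]) simp
  qed
qed

end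

section \<open>The case of equality in the dimension bound\<close>

locale maximal_nil_space = nil_space +
  fixes r :: nat
  assumes bound: "singular_bound E r"
    and dim_VV: "ends.dim VV = r * (dim E - r)"
begin

text \<open>The dimension of \<open>VV\<close> is at most the sum of
  \<open>dim (orbit x) + dim (partners x)\<close>, itself at most \<open>dim E - 1\<close>, and the
  dimension of the compressed space. The two upper bounds add up to exactly
  \<open>r * (dim E - r)\<close>, so both are attained.\<close>

lemma
  assumes x: "x \<in> E" "b x x = 0" and x': "x' \<in> E" "b x x' = 1" "b x' x' = 0"
  shows maximal_compress: "maximal_nil_space scale Basis b (E \<inter> perp {x, x'}) (compress x x' ` {u\<in>VV. u x = 0}) (r - 1)"
    and dim_orbit_partners_eq: "dim (orbit x) + dim (partners x) + 1 = dim E"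
proof -
  let ?E' = "E \<inter> perp {x, x'}" and ?V' = "compress x x' ` {u\<in>VV. u x = 0}"
  have x0: "x \<noteq> 0" using x'(2) by auto
  interpret c: nil_space scale Basis b ?E' ?V' by (rule compress_nil_space[OF x x'])
  note sb = singular_bound_hyperbolic[OF E bound x x']
  obtain B' where B': "finite B'" "card B' \<le> (r - 1) * (dim ?E' - (r - 1))" "?V' \<subseteq> ends.span B'"
    using nil_space_span_bound[OF c.nil_space_axioms sb(2)] by blast
  obtain B0 where B0: "B0 \<subseteq> ?V'" "ends.independent B0" "?V' \<subseteq> ends.span B0" "card B0 = ends.dim ?V'"
    using ends.basis_exists by blast
  have fB0: "finite B0" "card B0 \<le> card B'"
    using ends.independent_span_bound[OF B'(1) B0(2)] B0(1) B'(3) by auto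
  obtain B where B: "finite B" "card B \<le> dim (orbit x) + (card B0 + dim (partners x))" "VV \<subseteq> ends.span B"
    using span_bound_compress[OF x x' fB0(1) B0(3)] by blast
  have le: "ends.dim VV \<le> card B" by (rule ends.dim_le_card[OF B(3,1)])
  obtain s where s: "r = Suc s" using sb(1) by (cases r) auto
  obtain d where d: "dim ?E' = 2 * s + d"
    using sb(2) s by (auto simp: singular_bound_def le_iff_add)
  then have dE: "dim E = 2 * s + d + 2" using hyperbolic_complement(3)[OF E x x'] by simp
  have le2: "Suc s * (s + d + 1) \<le> dim (orbit x) + dim (partners x) + card B0"
    using le B(2) dim_VV unfolding dE s by simp
  have le3: "card B0 \<le> s * (s + d)"
    using B'(2) fB0(2) unfolding d s by simp
  have le4: "dim (orbit x) + dim (partners x) + 1 \<le> 2 * s + d + 2"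
    using dim_orbit_partners[OF x(1) x0] dE by simp
  show "dim (orbit x) + dim (partners x) + 1 = dim E"
    using le2 le3 le4 unfolding dE by (simp add: algebra_simps)
  have "card B0 = s * (s + d)"
    using le2 le3 le4 by (simp add: algebra_simps)
  then have "ends.dim ?V' = (r - 1) * (dim ?E' - (r - 1))"
    using B0(4) by (simp add: s d)
  then show "maximal_nil_space scale Basis b ?E' ?V' (r - 1)"
    by (unfold_locales) (use sb(2) in auto)
qed

text \<open>The converse of \<open>tens_orthogonal\<close>: equality of dimensions makes
  \<open>partners x\<close> fill the whole orthogonal complement of \<open>x\<close> and its orbit.
  This is the main source of elements of \<open>VV\<close>.\<close>

lemma tens_in_VV:
  assumes x: "x \<in> E" "b x x = 0" "x \<noteq> 0"
    and y: "y \<in> E" "b x y = 0" "\<And>u. u \<in> VV \<Longrightarrow> b y (u x) = 0"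
  shows "tens x y \<in> VV"
proof -
  obtain x' where x': "x' \<in> E" "b x x' = 1" "b x' x' = 0"
    using hyperbolic_partner[OF E x] by blast
  have "dim (partners x) = dim (E \<inter> perp (insert x (orbit x)))"
    using dim_orbit_partners_eq[OF x(1,2) x'] dim_insert_orbit_perp[OF x(1,3)] by simp
  then have "partners x = E \<inter> perp (insert x (orbit x))"
    using partners_subset subspace_partners subspace_inter[OF E(1) subspace_perp]
    by (intro subspace_dim_equal) auto
  moreover have "y \<in> E \<inter> perp (insert x (orbit x))"
    using y form_commute by (auto simp: perp_def orbit_def)
  ultimately show ?thesis by (auto simp: partners_def)
qed

end

section \<open>A common singular kernel vector\<close>

text \<open>The assumption \<open>second\<close> is what the induction hypothesis for \<open>x\<^sup>\<bottom>/x\<close> says about the original space.\<close>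

locale maximal_nil_step = maximal_nil_space +
  assumes second: "\<lbrakk>2 \<le> r; x \<in> E; b x x = 0; x \<noteq> 0\<rbrakk> \<Longrightarrow>
    \<exists>y\<in>E. b y y = 0 \<and> b x y = 0 \<and> y \<notin> span {x} \<and>
      (\<forall>\<eta>\<in>E. b x \<eta> = 0 \<longrightarrow> b y \<eta> = 0 \<longrightarrow> (\<exists>\<zeta>\<in>E. b x \<zeta> = 0 \<and> tens y \<eta> + tens x \<zeta> \<in> VV))"
begin

section \<open>Singular vectors whose tensor square lies in the space\<close>

definition square :: "'b \<Rightarrow> bool" where
  "square z \<longleftrightarrow> z \<in> E \<and> z \<noteq> 0 \<and> b z z = 0 \<and> tens z z \<in> VV"

text \<open>\<open>tens_in_VV\<close> with \<open>y = z\<close> asks only that \<open>z\<close> be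
  orthogonal to its own orbit.\<close>

lemma squareI:
  assumes "z \<in> E" "z \<noteq> 0" "b z z = 0" "\<And>u. u \<in> VV \<Longrightarrow> b z (u z) = 0"
  shows "square z"
  using assms tens_in_VV[of z z] by (simp add: square_def)

lemma square_moments: "square z \<Longrightarrow> v \<in> VV \<Longrightarrow> b z ((v ^^ k) z) = 0"
  using tens_moments(1) by (simp add: square_def)

lemma square_orbit:
  assumes z: "square z" and v: "v \<in> VV"
  shows "b z (v z) = 0" "b z (v (v z)) = 0" "b z (v (v (v z))) = 0"
  using square_moments[OF assms, of 1] square_moments[OF assms, of 2] square_moments[OF assms, of 3]
  by (simp_all add: numeral_2_eq_2 numeral_3_eq_3)

text \<open>Polarisation of \<open>b (w z) (w z) = b z (w (w z)) = 0\<close>.\<close>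

lemma square_orbit_singular:
  assumes z: "square z" and uv: "u \<in> VV" "v \<in> VV"
  shows "b (u z) (v z) = 0"
proof -
  have q: "b (w z) (w z) = 0" if "w \<in> VV" for w
    using square_orbit(2)[OF z that] VV_D(6)[OF that] by simp
  have "b (u z) (v z) + b (u z) (v z) = 0"
    using q[OF VV_add[OF uv]] q[OF uv(1)] q[OF uv(2)] by (simp add: form_commute)
  then show ?thesis by (simp only: double_eq_zero)
qed

lemma square_perp_moments:
  assumes z: "square z" and w: "w \<in> E" "b z w = 0" "\<forall>u\<in>VV. b w (u z) = 0"
    and v: "v \<in> VV"
  shows "b w ((v ^^ k) z) = 0"
proof -
  have "tens z w \<in> VV" using z w by (intro tens_in_VV) (auto simp: square_def)
  then have "b z ((v ^^ k) w) = 0" using v by (rule tens_moments(1))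
  then show ?thesis using VV_funpow_symmetric[OF v] form_commute by metis
qed

text \<open>The second moment gives the first claim; polarising it in the endomorphism gives the
  second.\<close>

lemma square_perp_anticommute:
  assumes z: "square z" and w: "w \<in> E" "b z w = 0" "\<forall>u\<in>VV. b w (u z) = 0"
    and uv: "u \<in> VV" "v \<in> VV"
  shows "b w (u (u z)) = 0" "b w (u (v z)) = - b w (v (u z))"
proof -
  have q: "b w (h (h z)) = 0" if "h \<in> VV" for h
    using square_perp_moments[OF z w that, of 2] by (simp add: numeral_2_eq_2)
  show "b w (u (u z)) = 0" by (rule q[OF uv(1)])
  have "b w (u (v z)) + b w (v (u z)) = 0"
    using q[OF VV_add[OF uv]] q[OF uv(1)] q[OF uv(2)]
    by (simp add: VV_D[OF uv(1)] VV_D[OF uv(2)])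
  then show "b w (u (v z)) = - b w (v (u z))" by (rule eq_neg_iff_add_eq_0[THEN iffD2])
qed

text \<open>By \<open>squareI\<close> it remains to show \<open>b y (v y) = 0\<close>. In the
  expansion every term but \<open>b (u z) (v (u z))\<close> vanishes because \<open>z\<close> and
  its orbit are mutually orthogonal and totally singular.\<close>

lemma square_combination:
  assumes z: "square z" and u: "u \<in> VV" and y: "y = s *s z + u z" "y \<noteq> 0"
  shows "square y"
proof (rule squareI)
  have zE: "z \<in> E" "b z z = 0" using z by (auto simp: square_def)
  show "y \<in> E" using zE E VV_range[OF u] by (auto simp: y(1) intro: subspace_add subspace_scale)
  show "y \<noteq> 0" by fact
  show "b y y = 0"
    using zE square_orbit_singular[OF z u u] square_orbit(1)[OF z u] form_commute[of "u z" z]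
    by (simp add: y(1))
  fix v assume v: "v \<in> VV"
  note uD = VV_D[OF u] and vD = VV_D[OF v]
  \<comment> \<open>Polarising \<open>b(z, v\<^sup>3 z) = 0\<close> leaves only the mixed term \<open>b(z, u v u z)\<close>.\<close>
  have uuv: "b z (u (u (v z))) = 0" "b z (v (u (u z))) = 0"
  proof -
    \<comment> \<open>\<open>v z\<close> is orthogonal to \<open>z\<close> and to its orbit, so it
      may take the role of \<open>w\<close>.\<close>
    have "b (v z) (u (u z)) = 0"
      by (rule square_perp_anticommute(1)[OF z VV_range[OF v] square_orbit(1)[OF z v] _ u v])
        (simp add: square_orbit_singular[OF z v])
    then show "b z (v (u (u z))) = 0" "b z (u (u (v z))) = 0"
      using uD(6) vD(6) form_commute by metis+
  qed
  have "2 * b z (u (v (u z))) = 0"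
  proof -
    have p: "b z ((u + v) ((u + v) ((u + v) z))) = 0" "b z ((u - v) ((u - v) ((u - v) z))) = 0"
      using square_orbit(3)[OF z] VV_add[OF u v] VV_diff[OF u v] by blast+
    have "b z ((u + v) ((u + v) ((u + v) z))) - b z ((u - v) ((u - v) ((u - v) z)))
      = 2 * (b z (u (u (v z))) + b z (u (v (u z))) + b z (v (u (u z))) + b z (v (v (v z))))"
      by (simp add: uD vD algebra_simps)
    then show ?thesis using p uuv square_orbit(3)[OF z v] by simp
  qed
  then have "b z (u (v (u z))) = 0" using two by simp
  then have "b (u z) (v (u z)) = 0" using uD(6) by simp
  moreover have "b z (v (u z)) = 0"
    using square_orbit_singular[OF z v u] vD(6) by simp
  moreover have "b (u z) (v z) = 0" by (rule square_orbit_singular[OF z u v])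
  ultimately show "b y (v y) = 0"
    using square_orbit(1)[OF z v] by (simp add: y(1) vD)
qed

lemma cyclic_iff: "y \<in> span (insert z (orbit z)) \<longleftrightarrow> (\<exists>s u. u \<in> VV \<and> y = s *s z + u z)"
proof -
  have "span (orbit z) = orbit z" using subspace_orbit by simp
  then have "y \<in> span (insert z (orbit z)) \<longleftrightarrow> (\<exists>s. y - s *s z \<in> orbit z)"
    by (simp only: span_breakdown_eq)
  also have "\<dots> \<longleftrightarrow> (\<exists>s u. u \<in> VV \<and> y = s *s z + u z)"
    by (auto simp: orbit_def image_iff diff_eq_eq add.commute)
  finally show ?thesis .
qed

text \<open>The vectors \<open>z\<close> and \<open>u z\<close> span a totally singular
  plane.\<close>

lemma square_moved_imp_two_le:
  assumes z: "square z" and u: "u \<in> VV" "u z \<noteq> 0"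
  shows "2 \<le> r"
proof -
  have zE: "z \<in> E" "b z z = 0" "z \<noteq> 0" using z by (auto simp: square_def)
  have ind: "u z \<notin> span {z}" using u VV_eigenvector[of u z] by (auto simp: span_singleton)
  have "totally_singular b {u z, z}"
    using zE square_orbit_singular[OF z u(1) u(1)] square_orbit(1)[OF z u(1)] form_commute[of "u z" z]
    by (auto simp: totally_singular_def)
  then have "totally_singular b (span {u z, z})" by (rule totally_singular_span)
  moreover have "span {u z, z} \<subseteq> E" using zE VV_range[OF u(1)] E(1) by (intro span_minimal) auto
  ultimately have "dim (span {u z, z}) \<le> r" using bound by (auto simp: singular_bound_def)
  moreover have "dim (span {u z, z}) = 2"
    using ind zE(3) by (simp only: dim_span) (simp add: dim_insert)
  ultimately show ?thesis by simp
qed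

section \<open>Descent to a stable plane and a common kernel vector\<close>

text \<open>Put \<open>e = u z\<close>. Elements of \<open>VV\<close> killing \<open>z\<close> map
  \<open>e\<close> into \<open>?W\<close>, by anticommutation and biorthogonality. Each lifted
  element \<open>tens y \<eta> + tens z \<zeta>\<close> kills \<open>z\<close>, and
  \<open>\<eta>\<close> is chosen so that its value at \<open>e\<close> isolates a nonzero multiple
  of \<open>y\<close> modulo \<open>z\<close>.\<close>

lemma second_in_cyclic:
  assumes z: "square z" and u: "u \<in> VV" "u z \<noteq> 0"
    and y: "y \<in> E" "b y y = 0" "b z y = 0"
    and lift: "\<And>\<eta>. \<lbrakk>\<eta> \<in> E; b z \<eta> = 0; b y \<eta> = 0\<rbrakk> \<Longrightarrow> \<exists>\<zeta>\<in>E. b z \<zeta> = 0 \<and> tens y \<eta> + tens z \<zeta> \<in> VV"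
  shows "y \<in> span (insert z (orbit z))"
proof -
  let ?W = "span (insert z (orbit z))"
  have zE: "z \<in> E" "b z z = 0" "z \<noteq> 0" using z by (auto simp: square_def)
  define e where "e = u z"
  have e: "e \<in> E" "b z e = 0" using VV_range[OF u(1)] square_orbit(1)[OF z u(1)] by (auto simp: e_def)
  have eW: "e \<in> ?W" using u(1) by (auto simp: e_def orbit_def intro: span_base)
  have zW: "z \<in> ?W" by (simp add: span_base)
  have WE: "?W \<subseteq> E" using zE orbit_subset E(1) by (intro span_minimal) auto
  have gW: "g e \<in> ?W" if g: "g \<in> VV" "g z = 0" for g
  proof (rule biorthogonal[OF E subspace_span WE VV_range[OF g(1)]])
    fix t assume t: "t \<in> E" "\<And>w. w \<in> ?W \<Longrightarrow> b w t = 0"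
    have "b t (h z) = 0" if "h \<in> VV" for h
      using t(2)[of "h z"] that by (auto simp: orbit_def form_commute intro: span_base)
    then have "b t (g (u z)) = - b t (u (g z))"
      using t(1) t(2)[OF zW] by (intro square_perp_anticommute(2)[OF z _ _ _ g(1) u(1)]) auto
    then show "b t (g e) = 0" by (simp add: e_def g(2) VV_D(3)[OF u(1)])
  qed
  have gapp: "b \<eta> e *s y + b y e *s \<eta> + b \<zeta> e *s z \<in> ?W"
    if "\<eta> \<in> E" "b z \<eta> = 0" "b y \<eta> = 0" "b z \<zeta> = 0" "tens y \<eta> + tens z \<zeta> \<in> VV" for \<eta> \<zeta>
  proof -
    have "(tens y \<eta> + tens z \<zeta>) z = 0"
      using that zE y form_commute[of \<eta> z] form_commute[of \<zeta> z] form_commute[of y z]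
      by (simp add: tens_apply)
    from gW[OF that(5) this] show ?thesis
      using e(2) by (simp add: tens_apply add.assoc)
  qed
  show ?thesis
  proof (cases "b y e = 0")
    \<comment> \<open>Here \<open>\<eta> = y\<close> works: the coefficient of \<open>y\<close> is
      \<open>2 * b y e\<close>.\<close>
    case False
    obtain \<zeta> where \<zeta>: "\<zeta> \<in> E" "b z \<zeta> = 0" "tens y y + tens z \<zeta> \<in> VV"
      using lift[OF y(1,3,2)] by blast
    have "b y e *s y + b y e *s y + b \<zeta> e *s z \<in> ?W" by (rule gapp[OF y(1,3,2) \<zeta>(2,3)])
    then have "(b y e *s y + b y e *s y + b \<zeta> e *s z) - b \<zeta> e *s z \<in> ?W"
      using zW by (intro span_diff span_scale)
    then have "(2 * b y e) *s y \<in> ?W" by (simp only: add_diff_cancel_right' scale_left_distrib[symmetric] mult_2[symmetric])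
    then have "(1 / (2 * b y e)) *s ((2 * b y e) *s y) \<in> ?W" by (rule span_scale)
    then show ?thesis using False two by simp
  next
    case True
    show ?thesis
    proof (cases "e \<in> span {z, y}")
      case True
      then obtain s where s: "e - s *s z \<in> span {y}" by (auto simp: span_breakdown_eq)
      then obtain t where t: "e - s *s z = t *s y" by (auto simp: span_singleton)
      have "t \<noteq> 0"
      proof
        assume "t = 0"
        then have "u z = s *s z" using t by (simp add: e_def)
        then show False using VV_eigenvector[OF u(1)] u(2) by simp
      qed
      have "t *s y \<in> ?W" unfolding t[symmetric] using eW zW by (intro span_diff span_scale)
      then have "(1 / t) *s (t *s y) \<in> ?W" by (rule span_scale)
      then show ?thesis using \<open>t \<noteq> 0\<close> by simp
    next
      case False
      have "span {z, y} \<subseteq> E" using zE y E(1) by (intro span_minimal) auto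
      \<comment> \<open>As \<open>e\<close> lies outside \<open>span {z, y}\<close>, some vector
        orthogonal to that span pairs nontrivially with \<open>e\<close>.\<close>
      then obtain \<eta> where \<eta>: "\<eta> \<in> E" "\<And>w. w \<in> span {z, y} \<Longrightarrow> b w \<eta> = 0" "b \<eta> e \<noteq> 0"
        using biorthogonal[OF E subspace_span _ e(1)] False by blast
      have \<eta>': "b z \<eta> = 0" "b y \<eta> = 0" using \<eta>(2) by (auto intro: span_base)
      obtain \<zeta> where \<zeta>: "\<zeta> \<in> E" "b z \<zeta> = 0" "tens y \<eta> + tens z \<zeta> \<in> VV"
        using lift[OF \<eta>(1) \<eta>'] by blast
      have "b \<eta> e *s y + b y e *s \<eta> + b \<zeta> e *s z \<in> ?W" by (rule gapp[OF \<eta>(1) \<eta>' \<zeta>(2,3)])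
      then have "(b \<eta> e *s y + b y e *s \<eta> + b \<zeta> e *s z) - b \<zeta> e *s z \<in> ?W"
        using zW by (intro span_diff span_scale)
      then have "b \<eta> e *s y \<in> ?W" using True by simp
      then have "(1 / b \<eta> e) *s (b \<eta> e *s y) \<in> ?W" by (rule span_scale)
      then show ?thesis using \<eta>(3) by simp
    qed
  qed
qed

text \<open>Low coefficients of the trace and determinant identities for the update by
  \<open>tens y \<eta> + tens z \<zeta>\<close> show that \<open>b \<eta> (v y)\<close> is the
  negative of \<open>b \<zeta> (v z)\<close> and that their product vanishes.\<close>

lemma square_pair_functional:
  assumes z: "square z" and y: "square y" and zy: "\<And>v k. v \<in> VV \<Longrightarrow> b z ((v ^^ k) y) = 0"
    and \<eta>: "\<eta> \<in> E" "b z \<eta> = 0" "b y \<eta> = 0" and \<zeta>: "b z \<zeta> = 0"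
    and a: "tens y \<eta> + tens z \<zeta> \<in> VV"
    and v: "v \<in> VV" "b \<eta> (v z) = 0"
  shows "b \<zeta> (v z) = 0"
proof -
  let ?a = "tens y \<eta> + tens z \<zeta>"
  have *: "b \<eta> (v y) + b \<zeta> (v z) = 0 \<and> b \<eta> (v z) * b \<zeta> y = 0 \<and>
      b \<eta> (v y) * b \<zeta> (v z) = b \<eta> (v z) * b \<zeta> (v y) + b \<eta> (v (v z)) * b \<zeta> y" if v: "v \<in> VV" for v
  proof -
    have v': "v + ?a \<in> VV" "v - ?a \<in> VV" using VV_add VV_diff v a by auto
    \<comment> \<open>On \<open>C\<close> the update, of rank four on the whole space, has rank two.\<close>
    define C where "C = {c. \<forall>k. b z ((v ^^ k) c) = 0 \<and> b y ((v ^^ k) c) = 0}"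
    have C0: "b z c = 0" "b y c = 0" if "c \<in> C" for c
      using that by (auto simp: C_def dest: spec[of _ 0])
    have Cv: "v c \<in> C" if "c \<in> C" for c
      using that unfolding C_def
      by (auto simp: funpow_swap1 simp flip: funpow.simps(2)[unfolded o_def, THEN fun_cong] dest: spec[of _ "Suc _"])
    have Cy: "y \<in> C" "z \<in> C"
    proof -
      show "y \<in> C" using zy[OF v] square_moments[OF y v] by (simp add: C_def)
      have "b y ((v ^^ k) z) = 0" for k
        using zy[OF v, of k] VV_funpow_symmetric[OF v] form_commute by metis
      then show "z \<in> C" using square_moments[OF z v] by (simp add: C_def)
    qed
    note upd = rank_two_update[where f = "b \<eta>" and g = "b \<zeta>" and C = C and x = y and y = z,
        OF VV_linear[OF v'(1)] VV_linear[OF v'(2)] VV_nilpotent[OF v]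
          VV_nilpotent[OF v'(1)] VV_nilpotent[OF v'(2)] two form_linear form_linear Cv _ _ Cy]
    have 1: "moment_poly (b \<eta>) v y + moment_poly (b \<zeta>) v z = 0"
      by (rule upd(1)) (auto simp: tens_apply C0)
    have 2: "moment_poly (b \<eta>) v y * moment_poly (b \<zeta>) v z = moment_poly (b \<eta>) v z * moment_poly (b \<zeta>) v y"
      by (rule upd(2)) (auto simp: tens_apply C0)
    have c: "coeff (moment_poly (b s) v t) k = b s ((v ^^ k) t)" for s t k
      by (simp add: VV_nilpotent[OF v] form_linear)
    have z0: "b \<eta> y = 0" "b \<eta> z = 0" "b \<zeta> z = 0" using \<eta> \<zeta> by (auto simp: form_commute)
    show ?thesis
      using arg_cong[OF 1, of "\<lambda>p. coeff p 1"] arg_cong[OF 2, of "\<lambda>p. coeff p 1"]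
        arg_cong[OF 2, of "\<lambda>p. coeff p 2"] unfolding coeff_mult_small
      by (simp add: c z0 numeral_2_eq_2)
  qed
  \<comment> \<open>Either \<open>\<eta>\<close> is orthogonal to the orbit of \<open>z\<close> and
    the first factor vanishes by \<open>square_perp_anticommute\<close>, or some \<open>h\<close>
    with \<open>b \<eta> (h z) \<noteq> 0\<close> forces \<open>b \<zeta> y = 0\<close>.\<close>
  have "b \<eta> (v (v z)) * b \<zeta> y = 0"
  proof (cases "\<forall>h\<in>VV. b \<eta> (h z) = 0")
    case True
    then show ?thesis using square_perp_anticommute(1)[OF z \<eta>(1,2) True v(1) v(1)] by simp
  next
    case False
    then obtain h where "h \<in> VV" "b \<eta> (h z) \<noteq> 0" by blast
    then show ?thesis using *[of h] by simp
  qed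
  then have "b \<eta> (v y) * b \<zeta> (v z) = 0" using *[OF v(1)] v(2) by simp
  moreover have "b \<eta> (v y) = - b \<zeta> (v z)" using *[OF v(1)] by (simp add: eq_neg_iff_add_eq_0)
  ultimately show ?thesis by simp
qed

text \<open>On \<open>VV\<close> the kernel of one linear functional is contained in the kernel of
  the other.\<close>

lemma functionals_proportional:
  assumes F: "\<And>v. v \<in> VV \<Longrightarrow> b \<eta> (v z) = 0 \<Longrightarrow> b \<zeta> (v z) = 0"
  shows "\<exists>c. \<forall>v\<in>VV. b \<zeta> (v z) = c * b \<eta> (v z)"
proof (cases "\<forall>h\<in>VV. b \<eta> (h z) = 0")
  case True
  then show ?thesis using F by auto
next
  case False
  then obtain h where h: "h \<in> VV" "b \<eta> (h z) \<noteq> 0" by blast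
  have "b \<zeta> (v z) = (b \<zeta> (h z) / b \<eta> (h z)) * b \<eta> (v z)" if v: "v \<in> VV" for v
  proof -
    let ?c = "b \<eta> (v z) / b \<eta> (h z)"
    have "v - end_scale scale ?c h \<in> VV" using v h(1) VV_diff VV_scale by blast
    moreover have "b \<eta> ((v - end_scale scale ?c h) z) = 0"
      using h(2) by (simp add: end_scale_def)
    ultimately have "b \<zeta> ((v - end_scale scale ?c h) z) = 0" by (rule F)
    then show ?thesis by (simp add: end_scale_def algebra_simps)
  qed
  then show ?thesis by blast
qed

text \<open>By proportionality \<open>\<zeta> - c *s \<eta>\<close> is orthogonal to the orbit of
  \<open>z\<close>, so \<open>tens z (\<zeta> - c *s \<eta>)\<close> lies in \<open>VV\<close> and
  can be subtracted.\<close>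

lemma square_pair_tens:
  assumes z: "square z" and y: "square y" and zy: "\<And>v k. v \<in> VV \<Longrightarrow> b z ((v ^^ k) y) = 0"
    and \<eta>: "\<eta> \<in> E" "b z \<eta> = 0" "b y \<eta> = 0" and \<zeta>: "\<zeta> \<in> E" "b z \<zeta> = 0"
    and a: "tens y \<eta> + tens z \<zeta> \<in> VV"
  shows "\<exists>c. tens (y + c *s z) \<eta> \<in> VV"
proof -
  have F: "b \<zeta> (v z) = 0" if "v \<in> VV" "b \<eta> (v z) = 0" for v
    by (rule square_pair_functional[OF z y _ \<eta> \<zeta>(2) a that]) (rule zy)
  have zE: "z \<in> E" "b z z = 0" "z \<noteq> 0" using z by (auto simp: square_def)
  have "\<exists>c. \<forall>v\<in>VV. b \<zeta> (v z) = c * b \<eta> (v z)" by (rule functionals_proportional) (rule F)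
  then obtain c where c: "\<And>v. v \<in> VV \<Longrightarrow> b \<zeta> (v z) = c * b \<eta> (v z)" by blast
  have "tens z (\<zeta> - c *s \<eta>) \<in> VV"
    by (rule tens_in_VV[OF zE])
      (use \<zeta> \<eta> E c in \<open>auto intro!: subspace_diff subspace_scale\<close>)
  then have "(tens y \<eta> + tens z \<zeta>) - tens z (\<zeta> - c *s \<eta>) \<in> VV" using a VV_diff by blast
  moreover have "(tens y \<eta> + tens z \<zeta>) - tens z (\<zeta> - c *s \<eta>) = tens (y + c *s z) \<eta>"
    by (simp add: tens_add tens_diff tens_scale)
  ultimately show ?thesis by auto
qed

text \<open>Makes \<open>c\<close> independent of \<open>\<eta>\<close>. If \<open>\<eta>\<close> is
  orthogonal to the orbit of \<open>z\<close>, every \<open>c\<close> works. Otherwise fix one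
  exceptional \<open>\<theta>\<close> with its \<open>c\<close>, and compare the scalars for
  \<open>\<eta>\<close>, \<open>\<theta>\<close> and \<open>\<eta> + \<theta>\<close>.\<close>

lemma square_pair_uniform:
  assumes z: "square z"
    and ex: "\<And>\<eta>. \<lbrakk>\<eta> \<in> E; b z \<eta> = 0; b y \<eta> = 0\<rbrakk> \<Longrightarrow> \<exists>c. tens (y + c *s z) \<eta> \<in> VV"
  shows "\<exists>c. \<forall>\<eta>\<in>E. b z \<eta> = 0 \<longrightarrow> b y \<eta> = 0 \<longrightarrow> tens (y + c *s z) \<eta> \<in> VV"
proof -
  have zE: "z \<in> E" "b z z = 0" "z \<noteq> 0" using z by (auto simp: square_def)
  have free: "tens (y + c *s z) \<eta> \<in> VV"
    if \<eta>: "\<eta> \<in> E" "b z \<eta> = 0" "b y \<eta> = 0" "\<And>v. v \<in> VV \<Longrightarrow> b \<eta> (v z) = 0" for c \<eta>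
  proof -
    obtain c' where c': "tens (y + c' *s z) \<eta> \<in> VV" using ex[OF \<eta>(1-3)] by blast
    have "tens z \<eta> \<in> VV" by (rule tens_in_VV[OF zE \<eta>(1,2)]) (rule \<eta>(4))
    then have "tens (y + c' *s z) \<eta> + end_scale scale (c - c') (tens z \<eta>) \<in> VV"
      using c' VV_add VV_scale by blast
    moreover have "tens (y + c' *s z) \<eta> + end_scale scale (c - c') (tens z \<eta>) = tens (y + c *s z) \<eta>"
      by (simp add: tens_add tens_scale ends.scale_left_diff_distrib)
    ultimately show ?thesis by simp
  qed
  show ?thesis
  proof (cases "\<forall>\<eta>\<in>E. b z \<eta> = 0 \<longrightarrow> b y \<eta> = 0 \<longrightarrow> (\<forall>v\<in>VV. b \<eta> (v z) = 0)")
    case True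
    then show ?thesis using free by blast
  next
    case False
    then obtain \<theta> h where \<theta>: "\<theta> \<in> E" "b z \<theta> = 0" "b y \<theta> = 0" and h: "h \<in> VV" "b \<theta> (h z) \<noteq> 0" by blast
    obtain c where c: "tens (y + c *s z) \<theta> \<in> VV" using ex[OF \<theta>] by blast
    have "tens (y + c *s z) \<eta> \<in> VV" if \<eta>: "\<eta> \<in> E" "b z \<eta> = 0" "b y \<eta> = 0" for \<eta>
    proof -
      obtain d where d: "tens (y + d *s z) \<eta> \<in> VV" using ex[OF \<eta>] by blast
      obtain e where e: "tens (y + e *s z) (\<eta> + \<theta>) \<in> VV"
        using ex[of "\<eta> + \<theta>"] \<eta> \<theta> E(1) by (auto intro: subspace_add)
      have "tens (y + d *s z) \<eta> + tens (y + c *s z) \<theta> - tens (y + e *s z) (\<eta> + \<theta>) \<in> VV"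
        using d c e VV_add VV_diff by blast
      moreover have "tens (y + d *s z) \<eta> + tens (y + c *s z) \<theta> - tens (y + e *s z) (\<eta> + \<theta>)
          = tens z ((d - e) *s \<eta> + (c - e) *s \<theta>)"
        by (auto simp: tens_def fun_eq_iff algebra_simps)
      ultimately have "tens z ((d - e) *s \<eta> + (c - e) *s \<theta>) \<in> VV" by simp
      then have rel: "(d - e) * b \<eta> (v z) + (c - e) * b \<theta> (v z) = 0" if "v \<in> VV" for v
        using tens_orthogonal[OF _ that] by fastforce
      show ?thesis
      proof (cases "d = e")
        case True
        then have "c = e" using rel[OF h(1)] h(2) by simp
        then show ?thesis using d True by simp
      next
        case False
        \<comment> \<open>The relation \<open>rel\<close> makes
          \<open>\<eta> - s *s \<theta>\<close> orthogonal to the orbit of \<open>z\<close>.\<close>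
        define s where "s = - (c - e) / (d - e)"
        have "b (\<eta> - s *s \<theta>) (v z) = 0" if "v \<in> VV" for v
          using rel[OF that] False by (simp add: s_def field_simps)
        then have "tens (y + c *s z) (\<eta> - s *s \<theta>) \<in> VV"
          using \<eta> \<theta> E(1) by (intro free) (auto intro: subspace_diff subspace_scale)
        then have "tens (y + c *s z) (\<eta> - s *s \<theta>) + end_scale scale s (tens (y + c *s z) \<theta>) \<in> VV"
          using c VV_add VV_scale by blast
        moreover have "tens (y + c *s z) (\<eta> - s *s \<theta>) + end_scale scale s (tens (y + c *s z) \<theta>)
            = tens (y + c *s z) \<eta>"
          by (simp add: tens_diff tens_scale)
        ultimately show ?thesis by simp
      qed
    qed
    then show ?thesis by blast
  qed
qed

text \<open>The vector \<open>y\<close> from \<open>second\<close> lies in the span of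
  \<open>z\<close> and its orbit, so it is a square. For suitable \<open>c\<close> the vector
  \<open>x = y + c *s z\<close> has \<open>tens x t\<close> in \<open>VV\<close> for all
  \<open>t\<close> orthogonal to \<open>z\<close> and \<open>x\<close>; then \<open>v x\<close> is
  orthogonal to all such \<open>t\<close>, hence lies in \<open>span {z, x}\<close>.\<close>

lemma square_descent:
  assumes z: "square z" and u: "u \<in> VV" "u z \<noteq> 0"
  obtains x where "square x" "x \<in> span (insert z (orbit z))" "x \<notin> span {z}"
    "\<And>v. v \<in> VV \<Longrightarrow> v x \<in> span {z, x}"
proof -
  have zE: "z \<in> E" "b z z = 0" "z \<noteq> 0" using z by (auto simp: square_def)
  have r: "2 \<le> r" by (rule square_moved_imp_two_le[OF z u])
  obtain y where y: "y \<in> E" "b y y = 0" "b z y = 0" "y \<notin> span {z}"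
    and lift: "\<And>\<eta>. \<lbrakk>\<eta> \<in> E; b z \<eta> = 0; b y \<eta> = 0\<rbrakk> \<Longrightarrow> \<exists>\<zeta>\<in>E. b z \<zeta> = 0 \<and> tens y \<eta> + tens z \<zeta> \<in> VV"
    using second[OF r zE] by blast
  let ?W = "span (insert z (orbit z))"
  have yW: "y \<in> ?W" by (rule second_in_cyclic[OF z u y(1-3) lift])
  have zW: "z \<in> ?W" by (simp add: span_base)
  have sq: "square t" if "t \<in> ?W" "t \<noteq> 0" for t
    using that square_combination[OF z] by (auto simp: cyclic_iff)
  have y0: "y \<noteq> 0" using y(4) span_zero by metis
  have ysq: "square y" by (rule sq[OF yW y0])
  \<comment> \<open>Polarisation of the moments, using that \<open>z\<close>, \<open>y\<close> and
    \<open>z + y\<close> are all squares.\<close>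
  have zy: "b z ((v ^^ k) y) = 0" if v: "v \<in> VV" for v k
  proof -
    have "z + y \<noteq> 0"
    proof
      assume "z + y = 0"
      then have "y = (-1) *s z" by (simp add: eq_neg_iff_add_eq_0 add.commute)
      then show False using y(4) span_scale[OF span_base[of z "{z}"], of "-1"] by simp
    qed
    then have "square (z + y)" using zW yW by (intro sq span_add)
    then have "b (z + y) ((v ^^ k) (z + y)) = 0" using v by (rule square_moments)
    moreover have "(v ^^ k) (z + y) = (v ^^ k) z + (v ^^ k) y"
      by (rule b_symmetricD(1)[OF b_symmetric_funpow[OF VV_symmetric[OF v]]])
    moreover have "b y ((v ^^ k) z) = b z ((v ^^ k) y)"
      using VV_funpow_symmetric[OF v] form_commute by metis
    ultimately have "b z ((v ^^ k) y) + b z ((v ^^ k) y) = 0"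
      using square_moments[OF z v, of k] square_moments[OF ysq v, of k] by simp
    then show ?thesis by (simp only: double_eq_zero)
  qed
  have ex: "\<exists>c. tens (y + c *s z) \<eta> \<in> VV" if \<eta>: "\<eta> \<in> E" "b z \<eta> = 0" "b y \<eta> = 0" for \<eta>
  proof -
    obtain \<zeta> where \<zeta>: "\<zeta> \<in> E" "b z \<zeta> = 0" "tens y \<eta> + tens z \<zeta> \<in> VV" using lift[OF \<eta>] by blast
    show ?thesis by (rule square_pair_tens[OF z ysq zy \<eta> \<zeta>])
  qed
  obtain c where c: "\<And>\<eta>. \<lbrakk>\<eta> \<in> E; b z \<eta> = 0; b y \<eta> = 0\<rbrakk> \<Longrightarrow> tens (y + c *s z) \<eta> \<in> VV"
    using square_pair_uniform[OF z ex] by blast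
  define x where "x = y + c *s z"
  have xs: "x \<notin> span {z}"
  proof
    assume "x \<in> span {z}"
    then have "x - c *s z \<in> span {z}" by (rule span_diff) (simp add: span_scale span_base)
    then show False using y(4) by (simp add: x_def)
  qed
  have xW: "x \<in> ?W" unfolding x_def using yW zW by (intro span_add span_scale)
  moreover have "x \<noteq> 0" using xs span_zero by metis
  ultimately have "square x" by (rule sq)
  moreover have "v x \<in> span {z, x}" if v: "v \<in> VV" for v
  proof (rule biorthogonal[OF E subspace_span _ VV_range[OF v]])
    show "span {z, x} \<subseteq> E" using zE \<open>square x\<close> E(1) by (intro span_minimal) (auto simp: square_def)
    fix t assume t: "t \<in> E" "\<And>w. w \<in> span {z, x} \<Longrightarrow> b w t = 0"
    have "b z t = 0" "b x t = 0" using t(2) by (auto intro: span_base)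
    then have "b y t = 0" by (simp add: x_def)
    have "tens x t \<in> VV" unfolding x_def by (rule c[OF t(1) \<open>b z t = 0\<close> \<open>b y t = 0\<close>])
    then show "b t (v x) = 0" using v by (rule tens_orthogonal)
  qed
  ultimately show thesis using that xW xs by blast
qed

text \<open>Apply to the relation for \<open>v y\<close> the last power of \<open>v\<close> that
  does not kill \<open>x\<close>: it kills \<open>y\<close>, so \<open>\<alpha> = 0\<close>, and
  \<open>y\<close> is an eigenvector of a nilpotent map.\<close>

lemma nilpotent_plane:
  assumes v: "v \<in> VV" and y: "y = v x" "v y = \<alpha> *s x + \<beta> *s y"
  shows "v y = 0"
proof (cases "x = 0")
  case True
  then show ?thesis by (simp add: y(1) VV_D(3)[OF v])
next
  case False
  have ex: "\<exists>k. (v ^^ k) x = 0" using VV_nilpotent[OF v] by (auto simp: nilpotent_end_def) metis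
  define k where "k = (LEAST k. (v ^^ k) x = 0)"
  have k: "(v ^^ k) x = 0" unfolding k_def using ex by (rule LeastI_ex)
  then obtain j where j: "k = Suc j" using False by (cases k) auto
  have xj: "(v ^^ j) x \<noteq> 0"
  proof
    assume "(v ^^ j) x = 0"
    then have "k \<le> j" unfolding k_def by (rule Least_le)
    then show False using j by simp
  qed
  have yj: "(v ^^ j) y = 0" using k by (simp add: j y(1) funpow_swap1)
  note vj = b_symmetricD[OF b_symmetric_funpow[OF VV_symmetric[OF v]]]
  have "(v ^^ j) (v y) = v ((v ^^ j) y)" by (simp add: funpow_swap1)
  then have "(v ^^ j) (\<alpha> *s x + \<beta> *s y) = 0" using yj VV_D(3)[OF v] by (simp add: y(2))
  then have "\<alpha> *s (v ^^ j) x = 0" using yj by (simp add: vj)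
  then have "\<alpha> = 0" using xj by simp
  then show ?thesis using VV_eigenvector[OF v, of y \<beta>] y(2) by simp
qed

text \<open>Two descents, from \<open>z\<close> to \<open>x\<close> and from \<open>x\<close> to
  \<open>x'\<close>, yield a plane \<open>Q\<close> stable under \<open>VV\<close>. Every element of
  \<open>VV\<close> squares to zero on \<open>Q\<close>, and a nonzero \<open>u x\<close> is then
  killed by all of \<open>VV\<close>.\<close>

lemma square_common_kernel:
  assumes z: "square z"
  shows "\<exists>x\<in>E. x \<noteq> 0 \<and> b x x = 0 \<and> (\<forall>u\<in>VV. u x = 0)"
proof (cases "\<forall>u\<in>VV. u z = 0")
  case True
  then show ?thesis using z by (auto simp: square_def)
next
  case False
  then obtain u0 where u0: "u0 \<in> VV" "u0 z \<noteq> 0" by blast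
  obtain x where x: "square x" "x \<in> span (insert z (orbit z))" "x \<notin> span {z}"
    "\<And>v. v \<in> VV \<Longrightarrow> v x \<in> span {z, x}"
    by (rule square_descent[OF z u0]) blast
  show ?thesis
  proof (cases "\<forall>u\<in>VV. u x = 0")
    case True
    then show ?thesis using x(1) by (auto simp: square_def)
  next
    case False
    then obtain u where u: "u \<in> VV" "u x \<noteq> 0" by blast
    obtain x' where x': "square x'" "x' \<in> span (insert x (orbit x))" "x' \<notin> span {x}"
      "\<And>v. v \<in> VV \<Longrightarrow> v x' \<in> span {x, x'}"
      by (rule square_descent[OF x(1) u]) blast
    define Q where "Q = span {x', x}"
    have Qs: "subspace Q" by (simp add: Q_def)
    have xQ: "x \<in> Q" "x' \<in> Q" by (auto simp: Q_def intro: span_base)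
    have "span (insert x (orbit x)) \<subseteq> span {z, x}"
      using x(4) by (intro span_minimal) (auto simp: orbit_def intro: span_base)
    then have "x' \<in> span (insert z {x})" using x'(2) by auto
    \<comment> \<open>Exchange: \<open>x'\<close> lies in \<open>span {z, x}\<close> but not in
      \<open>span {x}\<close>.\<close>
    then have "z \<in> Q" unfolding Q_def using x'(3) by (rule in_span_insert)
    then have zxQ: "span {z, x} \<subseteq> Q" using xQ Qs by (intro span_minimal) auto
    have stable: "v t \<in> Q" if v: "v \<in> VV" and t: "t \<in> Q" for v t
    proof -
      obtain \<alpha> \<beta> where "t = \<alpha> *s x' + \<beta> *s x" using t by (auto simp: Q_def span_pair)
      moreover have "v x \<in> Q" using x(4)[OF v] zxQ by auto
      moreover have "v x' \<in> Q" using x'(4)[OF v] by (simp add: Q_def insert_commute)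
      ultimately show ?thesis using Qs by (simp add: VV_D[OF v] subspace_add subspace_scale)
    qed
    have plane: "t \<in> span {x0, v x0}" if v: "v \<in> VV" "v x0 \<noteq> 0" and x0: "x0 \<in> Q" and t: "t \<in> Q" for v x0 t
    proof -
      have ind: "v x0 \<notin> span {x0}" using v VV_eigenvector[of v x0] by (auto simp: span_singleton)
      have x00: "x0 \<noteq> 0" using v VV_D(3)[OF v(1)] by auto
      have "dim (span {v x0, x0}) = 2" using ind x00 by (simp only: dim_span) (simp add: dim_insert)
      moreover have "dim Q \<le> 2"
        unfolding Q_def dim_span by (auto simp: dim_insert)
      moreover have "span {v x0, x0} \<subseteq> Q" using x0 stable[OF v(1) x0] Qs by (intro span_minimal) auto
      ultimately have "span {v x0, x0} = Q" using Qs by (intro subspace_dim_equal) auto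
      then show ?thesis using t by (simp add: insert_commute)
    qed
    have square_zero: "v (v x0) = 0" if v: "v \<in> VV" and x0: "x0 \<in> Q" for v x0
    proof (cases "v x0 = 0")
      case True
      then show ?thesis by (simp add: VV_D(3)[OF v])
    next
      case False
      have "v (v x0) \<in> span {x0, v x0}" by (rule plane[OF v False x0 stable[OF v stable[OF v x0]]])
      then show ?thesis using nilpotent_plane[OF v refl] by (auto simp: span_pair)
    qed
    define y where "y = u x"
    have y: "y \<in> Q" "y \<noteq> 0" "u y = 0" using u stable[OF u(1) xQ(1)] square_zero[OF u(1) xQ(1)] by (auto simp: y_def)
    \<comment> \<open>Since \<open>u + v\<close> also squares to zero on \<open>Q\<close> and
      \<open>u y = 0\<close>, one gets \<open>u (v y) = 0\<close>; this removes the
      \<open>x\<close>-component of \<open>v y\<close>.\<close>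
    have "v y = 0" if v: "v \<in> VV" for v
    proof -
      have uv: "u + v \<in> VV" using VV_add[OF u(1) v] .
      have "(u + v) ((u + v) y) = 0" by (rule square_zero[OF uv y(1)])
      then have uvy: "u (v y) = 0"
        using square_zero[OF v y(1)] by (simp add: y(3) VV_D(3)[OF u(1)] VV_D(1)[OF u(1)])
      obtain \<alpha> \<beta> where ab: "v y = \<alpha> *s x + \<beta> *s y"
        using plane[OF u xQ(1) stable[OF v y(1)]] by (auto simp: span_pair y_def)
      have "\<alpha> *s y = 0" using uvy unfolding ab by (simp add: VV_D[OF u(1)] y(3) y_def[symmetric])
      then have "v y = \<beta> *s y" using ab y(2) by simp
      then show ?thesis by (rule VV_eigenvector[OF v])
    qed
    moreover have "b y y = 0" unfolding y_def by (rule square_orbit_singular[OF x(1) u(1) u(1)])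
    moreover have "y \<in> E" unfolding y_def by (rule VV_range[OF u(1)])
    ultimately show ?thesis using y(2) by blast
  qed
qed

section \<open>Trace identities and the case without squares\<close>

lemma tens_pair_trace:
  assumes a: "tens y \<eta> + tens x \<zeta> \<in> VV" and v: "v \<in> VV"
  shows "b \<eta> (v y) + b \<zeta> (v x) = 0"
    and "\<lbrakk>b y y = 0; b x x = 0; b x y = 0; b x \<eta> = 0; b y \<eta> = 0; b x \<zeta> = 0\<rbrakk> \<Longrightarrow>
      b \<eta> \<eta> * b y (v y) + 2 * b y \<zeta> * b \<eta> (v x) + 2 * b \<eta> \<zeta> * b y (v x) + b \<zeta> \<zeta> * b x (v x) = 0"
proof -
  let ?a = "tens y \<eta> + tens x \<zeta>"
  \<comment> \<open>The four rank-one summands of the update pair the functionals of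
    \<open>\<eta>\<close>, \<open>y\<close>, \<open>\<zeta>\<close>, \<open>x\<close> with the
    vectors \<open>y\<close>, \<open>\<eta>\<close>, \<open>x\<close>,
    \<open>\<zeta>\<close>.\<close>
  define f where "f i = b ([\<eta>, y, \<zeta>, x] ! i)" for i
  define w where "w i = [y, \<eta>, x, \<zeta>] ! i" for i
  have v': "v + ?a \<in> VV" "v - ?a \<in> VV" using VV_add VV_diff v a by auto
  have f: "Vector_Spaces.linear scale (*) (f l)" for l unfolding f_def by (rule form_linear)
  note id = finite_rank_trace_identities[where f = f and w = w and m = 4, OF two VV_linear[OF v'(1)] VV_linear[OF v'(2)]
      VV_nilpotent[OF v] VV_nilpotent[OF v'(1)] VV_nilpotent[OF v'(2)] f]
  have upd: "(v + ?a) c = v c + (\<Sum>l<4. f l c *s w l)" "(v - ?a) c = v c - (\<Sum>l<4. f l c *s w l)" for c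
    by (simp_all add: sum_four f_def w_def tens_apply add.assoc numeral_3_eq_3)
  have sw: "b s (v t) = b t (v s)" for s t using VV_D(6)[OF v] form_commute by metis
  have "(\<Sum>i<4. f i (v (w i))) = 0" by (rule id(1)[OF upd])
  then have "2 * (b \<eta> (v y) + b \<zeta> (v x)) = 0"
    using sw[of y \<eta>] sw[of x \<zeta>] by (simp add: sum_four f_def w_def numeral_3_eq_3 algebra_simps)
  then show "b \<eta> (v y) + b \<zeta> (v x) = 0" using two by (metis mult_eq_0_iff)
  assume o: "b y y = 0" "b x x = 0" "b x y = 0" "b x \<eta> = 0" "b y \<eta> = 0" "b x \<zeta> = 0"
  have "(\<Sum>i<4. \<Sum>j<4. f i (w j) * f j (v (w i))) = 0" by (rule id(2)[OF upd])
  then show "b \<eta> \<eta> * b y (v y) + 2 * b y \<zeta> * b \<eta> (v x) + 2 * b \<eta> \<zeta> * b y (v x) + b \<zeta> \<zeta> * b x (v x) = 0"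
    using o sw[of x \<eta>] sw[of x y] form_commute[of \<eta> x] form_commute[of \<eta> y] form_commute[of \<zeta> x]
      form_commute[of \<zeta> y] form_commute[of y x] form_commute[of \<zeta> \<eta>]
    by (simp add: sum_four f_def w_def numeral_3_eq_3 algebra_simps)
qed

context
  assumes no_square: "\<And>z. \<not> square z"
begin

text \<open>As \<open>x\<close> is not a square, some \<open>h\<close> has
  \<open>b x (h x) \<noteq> 0\<close>. For every such element the alternative in
  \<open>tens_moments\<close> falls on \<open>y\<close>; the remaining elements become such after
  adding \<open>h\<close>. So a nonzero \<open>y\<close> would be a square.\<close>

lemma no_partner:
  assumes x: "x \<in> E" "b x x = 0" "x \<noteq> 0" and y: "y \<in> E" "tens x y \<in> VV"
  shows "y = 0"
proof (rule ccontr)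
  assume "y \<noteq> 0"
  obtain h where h: "h \<in> VV" "b x (h x) \<noteq> 0"
    using no_square[of x] squareI[of x] x by blast
  have off: "b y y = 0 \<and> b y (v y) = 0" if v: "v \<in> VV" "b x (v x) \<noteq> 0" for v
  proof -
    have "\<not> (\<forall>k. b x ((v ^^ k) x) = 0)" using v(2) by (auto intro: exI[of _ 1])
    then have "\<forall>k. b y ((v ^^ k) y) = 0" using tens_moments(2)[OF y(2) v(1)] by blast
    from spec[OF this, of 0] spec[OF this, of 1] show ?thesis by simp
  qed
  have "b y (v y) = 0" if v: "v \<in> VV" for v
  proof (cases "b x (v x) = 0")
    case True
    then have "b x ((v + h) x) \<noteq> 0" using h(2) by simp
    then have "b y ((v + h) y) = 0" using off VV_add[OF v h(1)] by blast
    then show ?thesis using off[OF h] by simp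
  next
    case False
    then show ?thesis using off[OF v] by simp
  qed
  then have "square y" using off[OF h] y(1) \<open>y \<noteq> 0\<close> by (intro squareI) auto
  then show False using no_square by blast
qed

lemma orbit_perp_trivial:
  assumes x: "x \<in> E" "b x x = 0" "x \<noteq> 0"
    and y: "y \<in> E" "b x y = 0" "\<And>u. u \<in> VV \<Longrightarrow> b y (u x) = 0"
  shows "y = 0"
  by (rule no_partner[OF x y(1)], rule tens_in_VV[OF x y(1,2)], rule y(3))

text \<open>Half of the given element is a rank-two update. Its determinant identity gives
  \<open>b y (v x) = 0\<close> whenever \<open>b x (v x) = 0\<close>, so the two functionals are
  proportional, and \<open>orbit_perp_trivial\<close> makes \<open>y\<close> a multiple of
  \<open>x\<close>.\<close>

lemma square_sum_impossible:
  assumes x: "x \<in> E" "b x x = 0" "x \<noteq> 0"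
    and y: "y \<in> E" "b y y = 0" "b x y = 0" "y \<notin> span {x}"
    and a: "tens y y + end_scale scale d (tens x x) \<in> VV"
  shows False
proof (cases "d = 0")
  case True
  then have "tens y y \<in> VV" using a by simp
  moreover have "y \<noteq> 0" using y(4) span_zero by metis
  ultimately show False using y no_square[of y] by (simp add: square_def)
next
  case False
  let ?a = "end_scale scale (1 / 2) (tens y y + end_scale scale d (tens x x))"
  have aV: "?a \<in> VV" using a by (rule VV_scale)
  have a_apply: "?a c = b y c *s y + b (d *s x) c *s x" for c
    using two
    by (simp add: end_scale_def tens_apply scale_right_distrib)
      (simp add: scale_left_distrib[symmetric] half_add_half distrib_left[symmetric] add_divide_distrib[symmetric])
  have F: "b y (v x) = 0" if v: "v \<in> VV" "b x (v x) = 0" for v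
  proof -
    have v': "v + ?a \<in> VV" "v - ?a \<in> VV" using VV_add VV_diff v aV by auto
    note upd = rank_two_update[where f = "b y" and g = "b (d *s x)" and C = UNIV and x = y and y = x,
        OF VV_linear[OF v'(1)] VV_linear[OF v'(2)] VV_nilpotent[OF v(1)]
          VV_nilpotent[OF v'(1)] VV_nilpotent[OF v'(2)] two form_linear form_linear]
    have 1: "moment_poly (b y) v y + moment_poly (b (d *s x)) v x = 0"
      by (rule upd(1)) (simp_all add: a_apply)
    have 2: "moment_poly (b y) v y * moment_poly (b (d *s x)) v x = moment_poly (b y) v x * moment_poly (b (d *s x)) v y"
      by (rule upd(2)) (simp_all add: a_apply)
    have c: "coeff (moment_poly (b s) v t) k = b s ((v ^^ k) t)" for s t k
      by (simp add: VV_nilpotent[OF v(1)] form_linear)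
    have "b y (v y) * (d * b x (v x)) = b y (v x) * (d * b x (v y))"
      using arg_cong[OF 2, of "\<lambda>p. coeff p 2"] x y form_commute[of y x]
      unfolding coeff_mult_small by (simp add: c)
    moreover have "b x (v y) = b y (v x)" using VV_D(6)[OF v(1)] form_commute by metis
    ultimately show ?thesis using v(2) False by simp
  qed
  obtain c where c: "\<And>v. v \<in> VV \<Longrightarrow> b y (v x) = c * b x (v x)"
    using functionals_proportional[of x x y] F by blast
  have "y - c *s x = 0"
    by (rule orbit_perp_trivial[OF x])
      (use x y c E(1) in \<open>auto intro!: subspace_diff subspace_scale\<close>)
  then have "y = c *s x" by simp
  then show False using y(4) by (auto simp: span_singleton)
qed

text \<open>Lifting \<open>\<eta> = y\<close> gives some \<open>\<theta>\<close> with
  \<open>tens y y + tens x \<theta>\<close> in \<open>VV\<close>. The trace identities force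
  \<open>\<theta>\<close> into \<open>span {x, y}\<close>; completing the square then contradicts
  \<open>square_sum_impossible\<close>.\<close>

lemma no_square_rank:
  assumes x: "x \<in> E" "b x x = 0" "x \<noteq> 0"
  shows "\<not> 2 \<le> r"
proof
  assume r: "2 \<le> r"
  obtain y where y: "y \<in> E" "b y y = 0" "b x y = 0" "y \<notin> span {x}"
    and lift: "\<And>\<eta>. \<lbrakk>\<eta> \<in> E; b x \<eta> = 0; b y \<eta> = 0\<rbrakk> \<Longrightarrow> \<exists>\<zeta>\<in>E. b x \<zeta> = 0 \<and> tens y \<eta> + tens x \<zeta> \<in> VV"
    using second[OF r x] by blast
  obtain \<theta> where \<theta>: "\<theta> \<in> E" "b x \<theta> = 0" "tens y y + tens x \<theta> \<in> VV"
    using lift[OF y(1,3,2)] by blast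
  \<comment> \<open>The second trace identity, with \<open>b y (v y)\<close> replaced by
    \<open>- b \<theta> (v x)\<close>, says that this vector is orthogonal to the orbit of
    \<open>x\<close>.\<close>
  have key: "- b \<eta> \<eta> *s \<theta> + (2 * b y \<zeta>) *s \<eta> + (2 * b \<eta> \<zeta>) *s y + b \<zeta> \<zeta> *s x = 0"
    if \<eta>: "\<eta> \<in> E" "b x \<eta> = 0" "b y \<eta> = 0" and \<zeta>: "\<zeta> \<in> E" "b x \<zeta> = 0" "tens y \<eta> + tens x \<zeta> \<in> VV" for \<eta> \<zeta>
  proof (rule orbit_perp_trivial[OF x])
    show "- b \<eta> \<eta> *s \<theta> + (2 * b y \<zeta>) *s \<eta> + (2 * b \<eta> \<zeta>) *s y + b \<zeta> \<zeta> *s x \<in> E"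
      using \<eta> \<zeta> \<theta> x y E(1) by (intro subspace_add subspace_scale)
    show "b x (- b \<eta> \<eta> *s \<theta> + (2 * b y \<zeta>) *s \<eta> + (2 * b \<eta> \<zeta>) *s y + b \<zeta> \<zeta> *s x) = 0"
      using \<eta> \<zeta> \<theta> x y by simp
    fix v assume v: "v \<in> VV"
    have "b y (v y) = - b \<theta> (v x)"
      using tens_pair_trace(1)[OF \<theta>(3) v] by (simp add: eq_neg_iff_add_eq_0)
    then show "b (- b \<eta> \<eta> *s \<theta> + (2 * b y \<zeta>) *s \<eta> + (2 * b \<eta> \<zeta>) *s y + b \<zeta> \<zeta> *s x) (v x) = 0"
      using tens_pair_trace(2)[OF \<zeta>(3) v y(2) x(2) y(3) \<eta>(2,3) \<zeta>(2)] by simp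
  qed
  have \<theta>y: "b y \<theta> = 0" and \<theta>\<theta>: "b \<theta> \<theta> = 0"
  proof -
    have k: "(2 * b y \<theta> + 2 * b y \<theta>) *s y + b \<theta> \<theta> *s x = 0"
      unfolding scale_left_distrib using key[OF y(1,3,2) \<theta>] y(2) by simp
    have c0: "2 * b y \<theta> + 2 * b y \<theta> = 0"
    proof (rule ccontr)
      assume n: "2 * b y \<theta> + 2 * b y \<theta> \<noteq> 0" (is "?c \<noteq> 0")
      have "?c *s y = - (b \<theta> \<theta> *s x)" using k by (simp add: eq_neg_iff_add_eq_0)
      then have "?c *s y \<in> span {x}" by (simp add: span_neg span_scale span_base)
      then have "(1 / ?c) *s (?c *s y) \<in> span {x}" by (rule span_scale)
      then show False using n y(4) by simp
    qed
    then show "b y \<theta> = 0" using two unfolding double_eq_zero by simp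
    show "b \<theta> \<theta> = 0" using k x(3) unfolding c0 by simp
  qed
  have "\<theta> \<in> span {x, y}"
  proof (cases "\<exists>\<eta>\<in>E. b x \<eta> = 0 \<and> b y \<eta> = 0 \<and> b \<eta> \<eta> \<noteq> 0")
    case True
    then obtain \<eta> where \<eta>: "\<eta> \<in> E" "b x \<eta> = 0" "b y \<eta> = 0" "b \<eta> \<eta> \<noteq> 0" by blast
    obtain \<zeta> where \<zeta>: "\<zeta> \<in> E" "b x \<zeta> = 0" "tens y \<eta> + tens x \<zeta> \<in> VV" using lift[OF \<eta>(1-3)] by blast
    define c where "c = 2 * b y \<zeta>"
    define p where "p = (2 * b \<eta> \<zeta>) *s y + b \<zeta> \<zeta> *s x"
    have eq: "b \<eta> \<eta> *s \<theta> = c *s \<eta> + p"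
      using key[OF \<eta>(1-3) \<zeta>] by (simp add: c_def p_def algebra_simps eq_neg_iff_add_eq_0)
    \<comment> \<open>\<open>p\<close> is singular and orthogonal to \<open>\<eta>\<close>, so
      singularity of \<open>\<theta>\<close> forces \<open>c = 0\<close>.\<close>
    have "b (c *s \<eta> + p) (c *s \<eta> + p) = c * c * b \<eta> \<eta>"
      using \<eta> x y form_commute[of \<eta> x] form_commute[of \<eta> y] form_commute[of y x]
      by (simp add: p_def)
    then have "c * c * b \<eta> \<eta> = 0" using \<theta>\<theta> by (simp flip: eq)
    then have "c = 0" using \<eta>(4) by simp
    then have "b \<eta> \<eta> *s \<theta> \<in> span {x, y}"
      unfolding eq p_def span_pair
      by (intro exI[of _ "b \<zeta> \<zeta>"] exI[of _ "2 * b \<eta> \<zeta>"]) (simp add: add.commute)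
    then have "(1 / b \<eta> \<eta>) *s (b \<eta> \<eta> *s \<theta>) \<in> span {x, y}" by (rule span_scale)
    then show ?thesis using \<eta>(4) by simp
  next
    \<comment> \<open>Now all vectors orthogonal to \<open>x\<close> and \<open>y\<close> are
      singular, \<open>\<theta>\<close> is one of them, and polarisation puts it in the double
      orthogonal of \<open>span {x, y}\<close>.\<close>
    case False
    show ?thesis
    proof (rule biorthogonal[OF E subspace_span _ \<theta>(1)])
      show "span {x, y} \<subseteq> E" using x y E(1) by (intro span_minimal) auto
      fix t assume t: "t \<in> E" "\<And>w. w \<in> span {x, y} \<Longrightarrow> b w t = 0"
      have xt: "b x t = 0" "b y t = 0" using t(2) by (auto intro: span_base)
      have "t + \<theta> \<in> E" using t \<theta> E(1) by (auto intro: subspace_add)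
      moreover have "b x (t + \<theta>) = 0" "b y (t + \<theta>) = 0" using xt \<theta>y \<theta>(2) by simp_all
      ultimately have "b (t + \<theta>) (t + \<theta>) = 0" using False by blast
      moreover have "b t t = 0" using False xt t by blast
      ultimately have "b t \<theta> + b t \<theta> = 0" using \<theta>\<theta> form_commute[of \<theta> t] by simp
      then show "b t \<theta> = 0" by (simp only: double_eq_zero)
    qed
  qed
  then obtain \<alpha> \<beta> where \<alpha>\<beta>: "\<theta> = \<alpha> *s x + \<beta> *s y" by (auto simp: span_pair)
  \<comment> \<open>Completing the square absorbs the mixed term \<open>tens x y\<close>.\<close>
  define y' where "y' = y + (\<beta> / 2) *s x"
  have "tens y' y' = tens y y + end_scale scale (\<beta> / 2 + \<beta> / 2) (tens x y) + end_scale scale (\<beta> / 2 * (\<beta> / 2)) (tens x x)"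
    by (simp only: y'_def tens_add tens_scale tens_commute[of y x] ends.scale_left_distrib ends.scale_scale
        ends.scale_right_distrib add.assoc)
  then have "tens y y + tens x \<theta> = tens y' y' + end_scale scale (\<alpha> - \<beta> / 2 * (\<beta> / 2)) (tens x x)"
    unfolding \<alpha>\<beta> half_add_half by (simp add: tens_add tens_scale ends.scale_left_diff_distrib algebra_simps)
  then have a': "tens y' y' + end_scale scale (\<alpha> - \<beta> / 2 * (\<beta> / 2)) (tens x x) \<in> VV" using \<theta>(3) by simp
  have "y' \<notin> span {x}"
  proof
    assume "y' \<in> span {x}"
    then have "y' - (\<beta> / 2) *s x \<in> span {x}" by (rule span_diff) (simp add: span_scale span_base)
    then show False using y(4) by (simp add: y'_def)
  qed
  moreover have "y' \<in> E" "b y' y' = 0" "b x y' = 0"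
    using x y E(1) form_commute[of y x] by (auto simp: y'_def intro: subspace_add subspace_scale)
  ultimately show False using square_sum_impossible[OF x _ _ _ _ a'] by blast
qed

end

end

section \<open>Induction on the rank bound\<close>

context form_space
begin

text \<open>The induction hypothesis for the compressed space supplies the assumption
  \<open>second\<close>. It then remains to find a square; without one the bound would be 1, the
  compressed space zero, and a nonzero element killing \<open>x\<close> would have the form excluded
  by \<open>no_partner\<close>.\<close>

lemma maximal_nil_space_common_kernel:
  assumes "maximal_nil_space scale Basis b E VV r" "0 < r"
  shows "\<exists>x\<in>E. x \<noteq> 0 \<and> b x x = 0 \<and> (\<forall>u\<in>VV. u x = 0)"
  using assms
proof (induction r arbitrary: E VV)
  case (Suc r E VV)
  interpret maximal_nil_space scale Basis b E VV "Suc r" by fact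
  have step: "maximal_nil_step scale Basis b E VV (Suc r)"
  proof unfold_locales
    fix x assume r: "2 \<le> Suc r" and x: "x \<in> E" "b x x = 0" "x \<noteq> 0"
    obtain x' where x': "x' \<in> E" "b x x' = 1" "b x' x' = 0"
      using hyperbolic_partner[OF E x] by blast
    let ?E' = "E \<inter> perp {x, x'}" and ?V' = "compress x x' ` {u\<in>VV. u x = 0}"
    interpret c: maximal_nil_space scale Basis b ?E' ?V' r
      using maximal_compress[OF x(1,2) x'] by simp
    obtain y where y: "y \<in> ?E'" "y \<noteq> 0" "b y y = 0" "\<forall>u\<in>?V'. u y = 0"
      using Suc.IH[OF c.maximal_nil_space_axioms] r by auto
    have xy: "b x y = 0" "b x' y = 0" using y(1) by (auto simp: perp_def)
    have "y \<notin> span {x}"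
      using xy(2) x'(2) y(2) form_commute[of x' x] by (auto simp: span_singleton)
    moreover have "\<exists>\<zeta>\<in>E. b x \<zeta> = 0 \<and> tens y \<eta> + tens x \<zeta> \<in> VV"
      if \<eta>: "\<eta> \<in> E" "b x \<eta> = 0" "b y \<eta> = 0" for \<eta>
    proof -
      have py: "proj x x' y = y" using xy by (simp add: proj_def)
      have p\<eta>: "proj x x' \<eta> \<in> ?E'" by (rule proj_in[OF E x(1,2) x' \<eta>(1)])
      have "b y (proj x x' \<eta>) = 0"
        using \<eta>(3) xy form_commute[of y x] form_commute[of y x'] by (simp add: proj_def)
      \<comment> \<open>The orbit of \<open>y\<close> under the compressed space is zero. A preimage
        \<open>u\<close> of this tensor differs from \<open>tens y \<eta>\<close> by an element of
        the kernel of compression, which supplies \<open>\<zeta>\<close>.\<close>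
      then have "tens y (proj x x' \<eta>) \<in> ?V'"
        using y by (intro c.tens_in_VV[OF y(1,3,2) p\<eta>]) auto
      then obtain u where u: "u \<in> VV" "u x = 0" "tens y (proj x x' \<eta>) = compress x x' u" by auto
      have comp_tens: "compress x x' (tens y \<eta>) = tens y (proj x x' \<eta>)"
        by (auto simp: fun_eq_iff compress_def tens_apply proj_linear py form_proj[OF E x(1,2) x'])
          (metis form_proj[OF E x(1,2) x'] py)
      let ?d = "u - tens y \<eta>"
      have dS: "?d \<in> b_symmetric scale b"
        using ends.subspace_diff[OF b_symmetric_subspace VV_symmetric[OF u(1)] tens_symmetric] .
      have dr: "range ?d \<subseteq> E"
        using VV_range[OF u(1)] y(1) \<eta>(1) E(1)
        by (auto simp: tens_apply intro!: subspace_diff subspace_add subspace_scale)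
      have dx: "?d x = 0"
        using u(2) \<eta>(2) xy(1) form_commute[of y x] form_commute[of \<eta> x] by (simp add: tens_apply)
      interpret l: Vector_Spaces.linear "end_scale scale" "end_scale scale" "compress x x'"
        by (rule compress_linear)
      have "compress x x' ?d = (\<lambda>_. 0)"
        by (simp only: l.diff comp_tens u(3) diff_self) (simp add: zero_fun_def)
      then obtain \<zeta> where \<zeta>: "\<zeta> \<in> E" "b x \<zeta> = 0" "?d = tens x \<zeta>"
        using compress_kernel[OF E x(1,2) x' dS dr dx] by blast
      have "tens y \<eta> + tens x \<zeta> = u" unfolding \<zeta>(3)[symmetric] by simp
      then show ?thesis using \<zeta> u(1) by auto
    qed
    ultimately show "\<exists>y\<in>E. b y y = 0 \<and> b x y = 0 \<and> y \<notin> span {x} \<and>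
      (\<forall>\<eta>\<in>E. b x \<eta> = 0 \<longrightarrow> b y \<eta> = 0 \<longrightarrow> (\<exists>\<zeta>\<in>E. b x \<zeta> = 0 \<and> tens y \<eta> + tens x \<zeta> \<in> VV))"
      using y(1,3) xy by blast
  qed
  interpret s: maximal_nil_step scale Basis b E VV "Suc r" by (rule step)
  have "\<exists>v\<in>VV. v \<noteq> (\<lambda>_. 0)"
  proof (rule ccontr)
    assume "\<not> ?thesis"
    then have "VV \<subseteq> ends.span {}" by (auto simp: zero_fun_def)
    then have "ends.dim VV \<le> card ({} :: ('v \<Rightarrow> 'v) set)" by (rule ends.dim_le_card) simp
    moreover have "2 * Suc r \<le> dim E" using bound by (simp add: singular_bound_def)
    ultimately show False using dim_VV by simp
  qed
  then obtain v where v: "v \<in> VV" "v \<noteq> (\<lambda>_. 0)" by blast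
  obtain x where x: "x \<in> range v" "x \<noteq> 0" "b x x = 0" "v x = 0"
    using nilpotent_symmetric_singular_kernel[OF VV_symmetric[OF v(1)] VV_nilpotent[OF v(1)] v(2)] by blast
  have xE: "x \<in> E" using x(1) VV_range[OF v(1)] by auto
  have "\<exists>z. s.square z"
  proof (rule ccontr)
    assume "\<not> ?thesis"
    then have ns: "\<And>z. \<not> s.square z" by blast
    then have r0: "r = 0" using s.no_square_rank[OF ns xE x(3,2)] by simp
    obtain x' where x': "x' \<in> E" "b x x' = 1" "b x' x' = 0"
      using hyperbolic_partner[OF E xE x(3,2)] by blast
    obtain B where B: "finite B" "card B \<le> 0" "compress x x' ` {u\<in>VV. u x = 0} \<subseteq> ends.span B"
      using nil_space_span_bound[OF compress_nil_space[OF xE x(3) x']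
          singular_bound_hyperbolic(2)[OF E bound xE x(3) x']] r0 by auto
    then have "compress x x' v \<in> ends.span {}" using v(1) x(4) by auto
    then have "compress x x' v = (\<lambda>_. 0)" by (simp add: zero_fun_def)
    moreover have "range v \<subseteq> E" using VV_range[OF v(1)] by auto
    ultimately obtain y where y: "y \<in> E" "b x y = 0" "v = tens x y"
      using compress_kernel[OF E xE x(3) x' VV_symmetric[OF v(1)] _ x(4)] by blast
    have "y = 0" using s.no_partner[OF ns xE x(3,2) y(1)] y(3) v(1) by simp
    then show False using v(2) y(3) by (auto simp: tens_def)
  qed
  then show ?case using s.square_common_kernel by blast
qed simp

section \<open>The flag\<close>

text \<open>Put a common kernel vector \<open>x\<close> in front of the flag \<open>G\<close>
  obtained for the compressed space. Conversely, a map \<open>u\<close> stabilizing the new flag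
  kills \<open>x\<close> and has the same compression as some \<open>v\<close> in \<open>VV\<close>;
  the difference is \<open>tens x y\<close>, which lies in \<open>VV\<close>.\<close>

lemma maximal_nil_space_flag:
  assumes "maximal_nil_space scale Basis b E VV r"
  shows "\<exists>F. (\<forall>i\<le>r. subspace (F i) \<and> F i \<subseteq> E \<and> dim (F i) = i) \<and> (\<forall>i<r. F i \<subseteq> F (Suc i)) \<and>
    totally_singular b (F r) \<and>
    VV = {u \<in> b_symmetric scale b. range u \<subseteq> E \<and> nilpotent_end u \<and> stabilizes u F r}"
  using assms
proof (induction r arbitrary: E VV)
  case (0 E VV)
  interpret maximal_nil_space scale Basis b E VV 0 by fact
  have zero: "u = 0" if "u \<in> b_symmetric scale b" "range u \<subseteq> E" "nilpotent_end u" for u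
    using singular_bound_zero_nilpotent[OF E bound that] by (simp add: zero_fun_def)
  have "VV = {0}" using zero VV_symmetric VV_range VV_nilpotent VV_zero by blast
  moreover have "{u \<in> b_symmetric scale b. range u \<subseteq> E \<and> nilpotent_end u \<and> stabilizes u (\<lambda>_. {0}) 0} = {0}"
    using zero VV_symmetric[OF VV_zero] VV_range[OF VV_zero] VV_nilpotent[OF VV_zero]
    by (auto simp: stabilizes_def)
  ultimately show ?case
    using subspace_0[OF E(1)] by (intro exI[of _ "\<lambda>_. {0}"]) (simp add: totally_singular_def)
next
  case (Suc r E VV)
  interpret maximal_nil_space scale Basis b E VV "Suc r" by fact
  obtain x where x: "x \<in> E" "x \<noteq> 0" "b x x = 0" and kill: "\<And>u. u \<in> VV \<Longrightarrow> u x = 0"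
    using maximal_nil_space_common_kernel[OF Suc.prems] by auto
  obtain x' where x': "x' \<in> E" "b x x' = 1" "b x' x' = 0"
    using hyperbolic_partner[OF E x(1,3,2)] by blast
  note xx = x(1,3) x'
  let ?E' = "E \<inter> perp {x, x'}" and ?V' = "compress x x' ` {u\<in>VV. u x = 0}"
  have "maximal_nil_space scale Basis b ?E' ?V' r" using maximal_compress[OF xx] by simp
  from Suc.IH[OF this] obtain G where
    G: "\<And>i. i \<le> r \<Longrightarrow> subspace (G i)" "\<And>i. i \<le> r \<Longrightarrow> G i \<subseteq> ?E'" "\<And>i. i \<le> r \<Longrightarrow> dim (G i) = i"
      "\<And>i. i < r \<Longrightarrow> G i \<subseteq> G (Suc i)" "totally_singular b (G r)"
    and V': "?V' = {u \<in> b_symmetric scale b. range u \<subseteq> ?E' \<and> nilpotent_end u \<and> stabilizes u G r}"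
    by auto
  \<comment> \<open>Indices shift by one: \<open>F (Suc j)\<close> is the preimage of
    \<open>G j\<close> modulo \<open>x\<close>.\<close>
  define F where "F i = (case i of 0 \<Rightarrow> {0} | Suc j \<Rightarrow> span (insert x (G j)))" for i
  have F0: "F 0 = {0}" and FS: "F (Suc j) = span (insert x (G j))" for j by (simp_all add: F_def)
  have mem: "t \<in> F (Suc j) \<longleftrightarrow> (\<exists>s. t - s *s x \<in> G j)" if "j \<le> r" for t j
  proof -
    have "span (G j) = G j" using G(1)[OF that] by simp
    then show ?thesis by (simp only: FS span_breakdown_eq)
  qed
  have x'x: "b x' x = 1" using x'(2) by (simp add: form_commute)
  have Gperp: "b x g = 0" "b x' g = 0" "g \<in> ?E'" if "j \<le> r" "g \<in> G j" for j g
    using G(2)[OF that(1)] that(2) by (auto simp: perp_def)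
  have dimF: "dim (F (Suc j)) = Suc j" if "j \<le> r" for j
  proof -
    have "span (G j) = G j" using G(1)[OF that] by simp
    moreover have "x \<notin> G j" using Gperp(2)[OF that, of x] x'x by auto
    ultimately have "x \<notin> span (G j)" by metis
    then show ?thesis unfolding FS dim_span by (simp add: dim_insert G(3)[OF that])
  qed
  have sub: "subspace (F i)" "F i \<subseteq> E" "dim (F i) = i" if "i \<le> Suc r" for i
  proof -
    show "subspace (F i)" by (cases i) (simp_all add: F0 FS)
    show "dim (F i) = i" using that dimF by (cases i) (simp_all add: F0)
    show "F i \<subseteq> E"
    proof (cases i)
      case 0
      then show ?thesis using subspace_0[OF E(1)] by (simp add: F0)
    next
      case (Suc j)
      then have "G j \<subseteq> E" using G(2)[of j] that by auto
      then show ?thesis using x(1) E(1) unfolding Suc FS by (intro span_minimal) auto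
    qed
  qed
  have mono: "F i \<subseteq> F (Suc i)" if "i < Suc r" for i
  proof (cases i)
    case 0
    then show ?thesis by (simp add: F0 FS span_zero)
  next
    case (Suc j)
    then have "G j \<subseteq> G (Suc j)" using G(4) that by simp
    then show ?thesis unfolding Suc FS by (intro span_mono) auto
  qed
  have sing: "totally_singular b (F (Suc r))"
    unfolding FS
  proof (rule totally_singular_span)
    show "totally_singular b (insert x (G r))"
      using G(5) x(3) Gperp(1)[of r] form_commute[of x] unfolding totally_singular_def by (metis insert_iff le_refl)
  qed
  have pG: "proj x x' g = g" if "j \<le> r" "g \<in> G j" for j g
    by (rule proj_id[OF E xx Gperp(3)[OF that]])
  have stab: "stabilizes u F (Suc r)" if u: "u \<in> VV" for u
    unfolding stabilizes_def
  proof (intro allI impI)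
    fix i assume i: "i \<le> Suc r"
    show "u ` F i \<subseteq> F i"
    proof (cases i)
      case 0
      then show ?thesis by (simp add: F0 VV_D(3)[OF u])
    next
      case (Suc j)
      then have j: "j \<le> r" using i by simp
      have "u t \<in> F (Suc j)" if "t \<in> F (Suc j)" for t
      proof -
        obtain s where s: "t - s *s x \<in> G j" using \<open>t \<in> F (Suc j)\<close> mem[OF j] by blast
        define g where "g = t - s *s x"
        have g: "g \<in> G j" using s by (simp add: g_def)
        have ut: "u t = u g" using kill[OF u] by (simp add: g_def VV_D[OF u])
        have "compress x x' u \<in> ?V'" using u kill[OF u] by blast
        then have "stabilizes (compress x x' u) G r" unfolding V' by simp
        then have "compress x x' u g \<in> G j" using g j by (auto simp: stabilizes_def)
        moreover have "b x (u g) = 0" using VV_D(6)[OF u, of x g] kill[OF u] by simp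
        ultimately have "u g - b x' (u g) *s x \<in> G j"
          by (simp add: compress_def pG[OF j g] proj_def[of x x' "u g"])
        then show ?thesis unfolding ut mem[OF j] by blast
      qed
      then show ?thesis unfolding Suc by blast
    qed
  qed
  have conv: "u \<in> VV" if u: "u \<in> b_symmetric scale b" "range u \<subseteq> E" "nilpotent_end u" "stabilizes u F (Suc r)" for u
  proof -
    note uD = b_symmetricD[OF u(1)]
    have st: "u t \<in> F (Suc j)" if "j \<le> r" "t \<in> F (Suc j)" for j t
      using u(4) that unfolding stabilizes_def by blast
    have ux: "u x = 0"
    proof -
      have "x \<in> F (Suc 0)" by (simp add: FS span_base)
      then obtain s where s: "u x - s *s x \<in> G 0" using st[of 0 x] mem[of 0] by auto
      \<comment> \<open>Thus \<open>F 1\<close> is the line of \<open>x\<close>, and nilpotency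
        leaves only the eigenvalue zero.\<close>
      have "G 0 \<subseteq> {0}" using G(3)[of 0] by simp
      then have "u x = s *s x" using s by auto
      then show ?thesis by (rule nilpotent_eigenvalue[OF b_symmetric_linear[OF u(1)] u(3)])
    qed
    have "stabilizes (compress x x' u) G r"
      unfolding stabilizes_def
    proof (intro allI impI subsetI)
      fix j h assume j: "j \<le> r" and "h \<in> compress x x' u ` G j"
      then obtain g where g: "g \<in> G j" "h = compress x x' u g" by blast
      have "g \<in> F (Suc j)" by (simp add: FS span_base g(1))
      then obtain s where s: "u g - s *s x \<in> G j" using st[OF j] mem[OF j] by blast
      have "h = proj x x' (u g)" by (simp add: g(2) compress_def pG[OF j g(1)])
      also have "\<dots> = proj x x' (u g - s *s x)"
        by (simp add: proj_linear proj_simps[OF E xx])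
      also have "\<dots> = u g - s *s x" by (rule pG[OF j s])
      finally show "h \<in> G j" using s by simp
    qed
    then have "compress x x' u \<in> ?V'"
      unfolding V' using compress_symmetric[OF E xx u(1,2)] compress_nilpotent[OF E xx u(1) ux u(3)] by simp
    then obtain v where v: "v \<in> VV" "compress x x' u = compress x x' v" by auto
    interpret l: Vector_Spaces.linear "end_scale scale" "end_scale scale" "compress x x'"
      by (rule compress_linear)
    have "compress x x' (u - v) = (\<lambda>_. 0)"
      by (simp only: l.diff v(2) diff_self) (simp add: zero_fun_def)
    moreover have "u - v \<in> b_symmetric scale b"
      by (rule ends.subspace_diff[OF b_symmetric_subspace u(1) VV_symmetric[OF v(1)]])
    moreover have "range (u - v) \<subseteq> E"
      using u(2) VV_range[OF v(1)] E(1) by (auto intro: subspace_diff)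
    moreover have "(u - v) x = 0" using ux kill[OF v(1)] by simp
    ultimately obtain y where y: "y \<in> E" "b x y = 0" "u - v = tens x y"
      using compress_kernel[OF E xx] by blast
    \<comment> \<open>The orbit of \<open>x\<close> is zero, so orthogonality to it holds
      trivially.\<close>
    have "tens x y \<in> VV" by (rule tens_in_VV[OF x(1,3,2) y(1,2)]) (simp add: kill)
    then have "v + (u - v) \<in> VV" using v(1) y(3) VV_add by metis
    then show ?thesis by simp
  qed
  have "VV = {u \<in> b_symmetric scale b. range u \<subseteq> E \<and> nilpotent_end u \<and> stabilizes u F (Suc r)}"
    using VV_symmetric VV_range VV_nilpotent stab conv by blast
  then show ?case using sub mono sing by (intro exI[of _ F]) blast
qed

section \<open>Specialisation to the whole space\<close>

text \<open>A totally singular subspace lies in its own orthogonal complement, so twice its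
  dimension is at most that of the whole space. The maximum is attained because the set of
  dimensions is finite and contains 0.\<close>

lemma singular_bound_witt_index: "singular_bound UNIV (witt_index scale b)"
proof -
  let ?S = "{dim X | X. subspace X \<and> totally_singular b X}"
  have w: "witt_index scale b = Max ?S" by (simp add: witt_index_def)
  have "?S \<subseteq> {..dim UNIV}" using dim_subset[OF subset_UNIV] by auto
  then have fin: "finite ?S" by (rule finite_subset) simp
  have "dim {0} \<in> ?S" using subspace_single_0 by (force simp: totally_singular_def)
  then have "Max ?S \<in> ?S" using fin by (intro Max_in) auto
  then obtain X where X: "subspace X" "totally_singular b X" "Max ?S = dim X" by auto
  have "nondegenerate_on UNIV"
    using nondeg by (simp add: nondegenerate_on_def nondegenerate_def)
  then have "dim X + dim (UNIV \<inter> perp X) = dim UNIV" using X(1) by (intro dim_perp) auto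
  moreover have "dim X \<le> dim (UNIV \<inter> perp X)"
    using X(2) by (intro dim_subset) (auto simp: totally_singular_def perp_def)
  moreover have "dim Y \<le> Max ?S" if "subspace Y" "totally_singular b Y" for Y
    using fin that by (intro Max_ge) auto
  ultimately show ?thesis unfolding singular_bound_def w using X(3) by auto
qed

end

theorem mainTheorem2:
  fixes scale :: "'a::field \<Rightarrow> 'v::ab_group_add \<Rightarrow> 'v"
    and b :: "'v \<Rightarrow> 'v \<Rightarrow> 'a"
    and n :: nat
    and \<V> :: "('v \<Rightarrow> 'v) set"
  assumes char: "(2::'a) \<noteq> 0"
    and fdim: "\<exists>Basis. finite_dimensional_vector_space scale Basis"
    and dimV: "vector_space.dim scale (UNIV :: 'v set) = n"
    and bil: "bilinear_form scale b"
    and sym: "symmetric_form b"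
    and nondeg: "nondegenerate b"
    and sub: "module.subspace (end_scale scale) \<V>"
    and inS: "\<V> \<subseteq> b_symmetric scale b"
    and nil: "\<forall>u\<in>\<V>. nilpotent_end u"
    and dimsp: "vector_space.dim (end_scale scale) \<V> = witt_index scale b * (n - witt_index scale b)"
  shows "\<exists>F p. maximal_pc_singular_flag scale b F p \<and> \<V> = WS scale b F p"
proof -
  obtain Basis where Basis: "finite_dimensional_vector_space scale Basis" using fdim by blast
  interpret finite_dimensional_vector_space scale Basis by (rule Basis)
  interpret form_space scale Basis b
    by unfold_locales (use char bil sym nondeg in auto)
  have "maximal_nil_space scale Basis b UNIV \<V> (witt_index scale b)"
  proof unfold_locales
    show "nondegenerate_on UNIV"
      using nondeg by (simp add: nondegenerate_on_def nondegenerate_def)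
    show "ends.dim \<V> = witt_index scale b * (dim UNIV - witt_index scale b)"
      using dimsp dimV by simp
  qed (use sub inS nil singular_bound_witt_index in auto)
  from maximal_nil_space_flag[OF this] obtain F where
    F: "\<forall>i\<le>witt_index scale b. subspace (F i) \<and> F i \<subseteq> UNIV \<and> dim (F i) = i"
      "\<forall>i<witt_index scale b. F i \<subseteq> F (Suc i)" "totally_singular b (F (witt_index scale b))"
      "\<V> = {u \<in> b_symmetric scale b. range u \<subseteq> UNIV \<and> nilpotent_end u \<and> stabilizes u F (witt_index scale b)}"
    by blast
  have "maximal_pc_singular_flag scale b F (witt_index scale b)"
    using F(1-3)
    by (simp add: maximal_pc_singular_flag_def is_flag_def partially_complete_def b_singular_flag_def)
  moreover have "\<V> = WS scale b F (witt_index scale b)" using F(4) by (simp add: WS_def)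
  ultimately show ?thesis by blast
qed

end
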